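(* If the tree $T(o)=\{w_\beta\restriction\gamma:\gamma\le\beta<\omega_1\}$ is special, then Moore's space $\mathscr L=\{w_\beta:\beta<\omega_1\}\subseteq\mathcal S^{\omega_1}$ is not a $\Delta$-space.
   Context: Ordinals are identified with the set of smaller ordinals. A $C$-sequence is a sequence $\langle C_\alpha:\alpha<\omega_1\rangle$ with $C_0=\emptyset$, $C_{\beta+1}=\{\beta\}$, and, for each limit ordinal $\alpha>0$, $C_\alpha$ a cofinal subset of $\alpha$ such that $C_\alpha\cap\xi$ is finite for all $\xi<\alpha$. Fix an arbitrary $C$-sequence. Upper trace: for $\alpha\le\beta<\omega_1$, $U(\alpha,\alpha)=\emptyset$ and, for $\alpha<\beta$, $U(\alpha,\beta)=U(\alpha,\min(C_\beta\setminus\alpha))\cup\{\beta\}$. Lower trace: $L(\alpha,\alpha)=\emptyset$ and, for $\alpha<\beta$, $L(\alpha,\beta)=\big(L(\alpha,\min(C_\beta\setminus\alpha))\cup\{\max(C_\beta\cap\alpha)\}\big)\setminus\max(C_\beta\cap\alpha)$ if $C_\beta\cap\alpha\ne\emptyset$ (subtracting the ordinal $\max(C_\beta\cap\alpha)$ removes all elements smaller than it), and $L(\alpha,\beta)=L(\alpha,\min(C_\beta\setminus\alpha))$ if $C_\beta\cap\alpha=\emptyset$. For $\beta<\omega_1$ define $e_\beta:\beta\to\omega$ by $e_\beta(\alpha)=\max\{|C_\xi\cap\alpha|:\xi\in U(\alpha,\beta)\}$. For $\alpha<\beta<\omega_1$, $\operatorname{osc}(\alpha,\beta)$ is the number of $\zeta\in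 L(\alpha,\beta)\setminus\{\min L(\alpha,\beta)\}$ such that $e_\alpha(\zeta^{-})\le e_\beta(\zeta^{-})$ and $e_\alpha(\zeta)>e_\beta(\zeta)$, where $\zeta^{-}$ is the immediate predecessor of $\zeta$ in $L(\alpha,\beta)$ (so it is $0$ if $L(\alpha,\beta)=\emptyset$). Let $\mathcal S=\{z\in\mathbb C: z\overline z=1\}$, and fix a rationally independent family $\{z_\alpha:\alpha<\omega_1\}\subseteq\mathcal S$ (for distinct $\alpha_1,\dots,\alpha_k$ and integers $n_1,\dots,n_k$, $\prod_i z_{\alpha_i}^{n_i}=1$ only if all $n_i=0$). For $\alpha<\beta$ put $o(\alpha,\beta)=z_\alpha^{\operatorname{osc}(\alpha,\beta)+1}$. For $\beta<\omega_1$ let $w_\beta\in\mathcal S^{\omega_1}$ be given by $w_\beta(\alpha)=o(\alpha,\beta)$ if $\alpha<\beta$ and $w_\beta(\alpha)=1$ otherwise. $\mathscr L$ carries the subspace topology from the product $\mathcal S^{\omega_1}$. $T(o)$ is ordered by end-extension of functions; it is an Aronszajn tree. A tree of height $\omega_1$ is special if it is a union of countably many antichains (sets of pairwise incomparable elements). A topological space $X$ is a $\Delta$-space if for every decreasing sequence $\{D_n:n\in\omega\}$ of subsets of $X$ with $\bigcap_n D_n=\emptyset$ there is a decreasing sequence $\{U_n:n\in\omega\}$ of open subsets of $X$ with $U_n\supseteq D_n$ for all $n$ and $\bigcap_n U_n=\emptyset$. *)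

theory Defs
  imports "HOL-Analysis.Analysis"
begin

unbundle cardinal_syntax

text \<open>The first uncountable ordinal as a well-ordered type.\<close>

typedef omega1 = "Field (cardSuc natLeq)"
proof -
  have "infinite (Field (cardSuc natLeq))"
    using cardSuc_finite[OF natLeq_Card_order] by (simp add: Field_natLeq)
  then show ?thesis by (metis ex_in_conv finite.emptyI)
qed

lemma Well_order_cardSuc_natLeq: "Well_order (cardSuc natLeq)"
  using cardSuc_Card_order[OF natLeq_Card_order] card_order_on_well_order_on by blast

instantiation omega1 :: ord
begin

definition less_eq_omega1 :: "omega1 \<Rightarrow> omega1 \<Rightarrow> bool" where
  "x \<le> y \<longleftrightarrow> (Rep_omega1 x, Rep_omega1 y) \<in> cardSuc natLeq"

definition less_omega1 :: "omega1 \<Rightarrow> omega1 \<Rightarrow> bool" where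
  "(x :: omega1) < y \<longleftrightarrow> x \<le> y \<and> x \<noteq> y"

instance ..

end

instance omega1 :: wellorder
proof -
  let ?r = "cardSuc natLeq"
  have lin: "Linear_order ?r" and wf: "wf (?r - Id)"
    using Well_order_cardSuc_natLeq by (auto simp: well_order_on_def)
  have refl: "\<And>a. a \<in> Field ?r \<Longrightarrow> (a, a) \<in> ?r"
    and trans: "trans ?r" and antisym: "antisym ?r" and tot: "Total ?r"
    using lin by (auto simp: linear_order_on_def partial_order_on_def preorder_on_def refl_on_def)
  have antis: "x = y" if "x \<le> y" "y \<le> x" for x y :: omega1
    using that antisym unfolding less_eq_omega1_def
    by (metis antisymD Rep_omega1_inject)
  show "OFCLASS(omega1, wellorder_class)"
  proof
    fix x y z :: omega1
    show "x < y \<longleftrightarrow> x \<le> y \<and> \<not> y \<le> x"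
      using antis refl[OF Rep_omega1[of x]] by (auto simp: less_omega1_def less_eq_omega1_def)
    show "x \<le> x"
      using refl[OF Rep_omega1] by (simp add: less_eq_omega1_def)
    show "x \<le> z" if "x \<le> y" "y \<le> z"
      using that trans unfolding less_eq_omega1_def by (meson transD)
    show "x = y" if "x \<le> y" "y \<le> x"
      using that by (rule antis)
    show "x \<le> y \<or> y \<le> x"
      using tot refl Rep_omega1[of x] Rep_omega1[of y] unfolding less_eq_omega1_def total_on_def
      by (cases "Rep_omega1 x = Rep_omega1 y") auto
  next
    fix P :: "omega1 \<Rightarrow> bool" and a :: omega1
    assume step: "\<And>x. (\<And>y. y < x \<Longrightarrow> P y) \<Longrightarrow> P x"
    have eq: "{(x, y). x < y} = inv_image (?r - Id) Rep_omega1"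
      by (auto simp: less_omega1_def less_eq_omega1_def inv_image_def Rep_omega1_inject)
    have "wf {(x, y). x < (y :: omega1)}"
      unfolding eq using wf by (rule wf_inv_image)
    then show "P a"
      by (induct a rule: wf_induct_rule) (auto intro: step)
  qed
qed

lemma countable_iff_ordLeq_natLeq: "countable A \<longleftrightarrow> |A| \<le>o natLeq"
proof -
  have "countable A \<longleftrightarrow> |A| \<le>o |UNIV :: nat set|"
    by (simp add: countable_def card_of_ordLeq[symmetric])
  also have "\<dots> \<longleftrightarrow> |A| \<le>o natLeq"
    using card_of_nat ordIso_symmetric ordLeq_ordIso_trans by blast
  finally show ?thesis .
qed

lemma uncountable_omega1: "uncountable (UNIV :: omega1 set)"
proof
  assume "countable (UNIV :: omega1 set)"
  then have "countable (Field (cardSuc natLeq))"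
    using type_definition.Rep_range[OF type_definition_omega1] by (metis countable_image)
  then have "|Field (cardSuc natLeq)| \<le>o natLeq"
    by (simp add: countable_iff_ordLeq_natLeq)
  moreover have "|Field (cardSuc natLeq)| =o cardSuc natLeq"
    by (rule card_of_Field_ordIso[OF cardSuc_Card_order[OF natLeq_Card_order]])
  ultimately have "cardSuc natLeq \<le>o natLeq"
    using ordIso_ordLeq_trans ordIso_symmetric by blast
  then show False
    using cardSuc_greater[OF natLeq_Card_order] not_ordLess_ordLeq by blast
qed

lemma countable_lessThan_omega1: "countable {..<\<alpha> :: omega1}"
proof -
  have "|underS (cardSuc natLeq) (Rep_omega1 \<alpha>)| <o cardSuc natLeq"
    by (rule card_of_underS[OF cardSuc_Card_order[OF natLeq_Card_order] Rep_omega1])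
  then have "countable (underS (cardSuc natLeq) (Rep_omega1 \<alpha>))"
    unfolding countable_iff_ordLeq_natLeq
    by (rule iffD1[OF cardSuc_ordLeq_ordLess[OF natLeq_Card_order card_of_Card_order]])
  moreover have "Rep_omega1 ` {..<\<alpha>} \<subseteq> underS (cardSuc natLeq) (Rep_omega1 \<alpha>)"
    by (auto simp: underS_def less_omega1_def less_eq_omega1_def Rep_omega1_inject)
  ultimately have "countable (Rep_omega1 ` {..<\<alpha>})"
    using countable_subset by blast
  then show ?thesis
    by (rule countable_image_inj_on) (simp add: inj_on_def Rep_omega1_inject)
qed

instantiation omega1 :: zero
begin
definition zero_omega1 :: omega1 where "(0 :: omega1) = (LEAST x. True)"
instance ..
end

definition osuc :: "omega1 \<Rightarrow> omega1" where
  "osuc \<beta> = (LEAST \<gamma>. \<beta> < \<gamma>)"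

definition is_limit :: "omega1 \<Rightarrow> bool" where
  "is_limit \<alpha> \<longleftrightarrow> \<alpha> \<noteq> 0 \<and> (\<forall>\<beta>. \<alpha> \<noteq> osuc \<beta>)"

lemma less_osuc: "\<beta> < osuc \<beta>"
proof -
  have "\<exists>\<gamma>. \<beta> < \<gamma>"
  proof (rule ccontr)
    assume "\<not> ?thesis"
    then have "UNIV = insert \<beta> {..<\<beta>}" by (auto simp: not_less le_less)
    then show False
      using uncountable_omega1 countable_lessThan_omega1[of \<beta>] by (metis countable_insert)
  qed
  then show ?thesis unfolding osuc_def by (rule LeastI_ex)
qed

lemma less_osuc_iff: "\<alpha> < osuc \<beta> \<longleftrightarrow> \<alpha> \<le> \<beta>"
proof
  show "\<alpha> < osuc \<beta> \<Longrightarrow> \<alpha> \<le> \<beta>"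
    unfolding osuc_def by (metis not_less_Least not_less)
  show "\<alpha> \<le> \<beta> \<Longrightarrow> \<alpha> < osuc \<beta>"
    by (rule le_less_trans[OF _ less_osuc])
qed

definition C_sequence :: "(omega1 \<Rightarrow> omega1 set) \<Rightarrow> bool" where
  "C_sequence C \<longleftrightarrow>
     C 0 = {} \<and>
     (\<forall>\<beta>. C (osuc \<beta>) = {\<beta>}) \<and>
     (\<forall>\<alpha>. is_limit \<alpha> \<longrightarrow>
        C \<alpha> \<subseteq> {..<\<alpha>} \<and>
        (\<forall>\<xi><\<alpha>. \<exists>\<eta>\<in>C \<alpha>. \<xi> \<le> \<eta>) \<and>
        (\<forall>\<xi><\<alpha>. finite (C \<alpha> \<inter> {..<\<xi>})))"

definition walk_step :: "(omega1 \<Rightarrow> omega1 set) \<Rightarrow> omega1 \<Rightarrow> omega1 \<Rightarrow> omega1" where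
  "walk_step C \<alpha> \<beta> = (LEAST \<xi>. \<xi> \<in> C \<beta> - {..<\<alpha>})"

text \<open>The guard \<^term>\<open>walk_step C \<alpha> \<beta> < \<beta>\<close> in the two recursions below only secures
  termination for arbitrary \<^term>\<open>C\<close>; it always holds for a C-sequence, for which the lemmas
  after the definitions give the unguarded recursion equations.\<close>

function upper_trace :: "(omega1 \<Rightarrow> omega1 set) \<Rightarrow> omega1 \<Rightarrow> omega1 \<Rightarrow> omega1 set" where
  "upper_trace C \<alpha> \<beta> =
     (if \<alpha> < \<beta> \<and> walk_step C \<alpha> \<beta> < \<beta>
      then upper_trace C \<alpha> (walk_step C \<alpha> \<beta>) \<union> {\<beta>}
      else {})"
  by pat_completeness auto
termination
  by (relation "inv_image {(x, y). x < y} (\<lambda>(C, \<alpha>, \<beta>). \<beta>)") (auto intro: wf)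

function lower_trace :: "(omega1 \<Rightarrow> omega1 set) \<Rightarrow> omega1 \<Rightarrow> omega1 \<Rightarrow> omega1 set" where
  "lower_trace C \<alpha> \<beta> =
     (if \<alpha> < \<beta> \<and> walk_step C \<alpha> \<beta> < \<beta>
      then
        (if C \<beta> \<inter> {..<\<alpha>} \<noteq> {}
         then (lower_trace C \<alpha> (walk_step C \<alpha> \<beta>) \<union> {Max (C \<beta> \<inter> {..<\<alpha>})})
                - {..<Max (C \<beta> \<inter> {..<\<alpha>})}
         else lower_trace C \<alpha> (walk_step C \<alpha> \<beta>))
      else {})"
  by pat_completeness auto
termination
  by (relation "inv_image {(x, y). x < y} (\<lambda>(C, \<alpha>, \<beta>). \<beta>)") (auto intro: wf)

declare upper_trace.simps [simp del] lower_trace.simps [simp del]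

lemma C_sequence_cofinal:
  assumes "C_sequence C" "\<alpha> < \<beta>"
  shows "\<exists>\<xi>. \<xi> \<in> C \<beta> - {..<\<alpha>}"
proof -
  have "\<beta> \<noteq> 0"
    using assms(2) not_less_Least[of \<alpha> "\<lambda>_. True"] by (auto simp: zero_omega1_def)
  then consider \<gamma> where "\<beta> = osuc \<gamma>" | "is_limit \<beta>"
    by (auto simp: is_limit_def)
  then show ?thesis
    using assms by cases (auto simp: C_sequence_def less_osuc_iff not_less Bex_def)
qed

lemma C_sequence_subset:
  assumes "C_sequence C"
  shows "C \<beta> \<subseteq> {..<\<beta>}"
proof -
  consider "\<beta> = 0" | \<gamma> where "\<beta> = osuc \<gamma>" | "is_limit \<beta>"
    by (auto simp: is_limit_def)
  then show ?thesis
    using assms less_osuc by cases (auto simp: C_sequence_def)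
qed

lemma C_sequence_finite:
  assumes "C_sequence C" "\<alpha> < \<beta>"
  shows "finite (C \<beta> \<inter> {..<\<alpha>})"
proof -
  consider "\<beta> = 0" | \<gamma> where "\<beta> = osuc \<gamma>" | "is_limit \<beta>"
    by (auto simp: is_limit_def)
  then show ?thesis
    using assms by cases (auto simp: C_sequence_def)
qed

lemma walk_step_less:
  assumes "C_sequence C" "\<alpha> < \<beta>"
  shows "walk_step C \<alpha> \<beta> < \<beta>"
  using LeastI_ex[OF C_sequence_cofinal[OF assms]] C_sequence_subset[OF assms(1), of \<beta>]
  by (auto simp: walk_step_def)

lemma upper_trace_refl: "upper_trace C \<alpha> \<alpha> = {}"
  by (simp add: upper_trace.simps)

lemma upper_trace_rec:
  assumes "C_sequence C" "\<alpha> < \<beta>"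
  shows "upper_trace C \<alpha> \<beta> = upper_trace C \<alpha> (walk_step C \<alpha> \<beta>) \<union> {\<beta>}"
  using assms walk_step_less[OF assms] by (subst upper_trace.simps) simp

lemma lower_trace_refl: "lower_trace C \<alpha> \<alpha> = {}"
  by (simp add: lower_trace.simps)

lemma lower_trace_rec:
  assumes "C_sequence C" "\<alpha> < \<beta>"
  shows "lower_trace C \<alpha> \<beta> =
    (if C \<beta> \<inter> {..<\<alpha>} \<noteq> {}
     then (lower_trace C \<alpha> (walk_step C \<alpha> \<beta>) \<union> {Max (C \<beta> \<inter> {..<\<alpha>})})
            - {..<Max (C \<beta> \<inter> {..<\<alpha>})}
     else lower_trace C \<alpha> (walk_step C \<alpha> \<beta>))"
  using assms walk_step_less[OF assms] by (subst lower_trace.simps) simp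

lemma finite_upper_trace: "finite (upper_trace C \<alpha> \<beta>)"
  by (induction C \<alpha> \<beta> rule: upper_trace.induct) (subst upper_trace.simps, simp)

lemma finite_lower_trace: "finite (lower_trace C \<alpha> \<beta>)"
  by (induction C \<alpha> \<beta> rule: lower_trace.induct) (subst lower_trace.simps, simp)

lemma lower_trace_subset:
  assumes "C_sequence C"
  shows "lower_trace C \<alpha> \<beta> \<subseteq> {..<\<alpha>}"
proof (induction \<beta> rule: less_induct)
  case (less \<beta>)
  show ?case
  proof (cases "\<alpha> < \<beta>")
    case True
    have "Max (C \<beta> \<inter> {..<\<alpha>}) < \<alpha>" if "C \<beta> \<inter> {..<\<alpha>} \<noteq> {}"
      using Max_in[OF C_sequence_finite[OF assms True] that] by simp
    with less[OF walk_step_less[OF assms True]] show ?thesis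
      by (auto simp: lower_trace_rec[OF assms True])
  qed (simp add: lower_trace.simps)
qed

text \<open>Only meaningful for \<^term>\<open>\<alpha> < \<beta>\<close>, when the upper trace is nonempty.\<close>

definition e_fun :: "(omega1 \<Rightarrow> omega1 set) \<Rightarrow> omega1 \<Rightarrow> omega1 \<Rightarrow> nat" where
  "e_fun C \<beta> \<alpha> = Max {card (C \<xi> \<inter> {..<\<alpha>}) | \<xi>. \<xi> \<in> upper_trace C \<alpha> \<beta>}"

definition pred_in :: "omega1 set \<Rightarrow> omega1 \<Rightarrow> omega1" where
  "pred_in L \<zeta> = Max {\<eta> \<in> L. \<eta> < \<zeta>}"

definition osc :: "(omega1 \<Rightarrow> omega1 set) \<Rightarrow> omega1 \<Rightarrow> omega1 \<Rightarrow> nat" where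
  "osc C \<alpha> \<beta> =
     (let L = lower_trace C \<alpha> \<beta> in
      card {\<zeta> \<in> L - {Min L}.
              e_fun C \<alpha> (pred_in L \<zeta>) \<le> e_fun C \<beta> (pred_in L \<zeta>) \<and>
              e_fun C \<alpha> \<zeta> > e_fun C \<beta> \<zeta>})"

definition circle :: "complex set" where
  "circle = {z. z * cnj z = 1}"

definition rationally_independent :: "('i \<Rightarrow> complex) \<Rightarrow> bool" where
  "rationally_independent z \<longleftrightarrow>
     (\<forall>F (n :: 'i \<Rightarrow> int). finite F \<longrightarrow> (\<Prod>\<alpha>\<in>F. z \<alpha> powi n \<alpha>) = 1 \<longrightarrow> (\<forall>\<alpha>\<in>F. n \<alpha> = 0))"

definition o_fun ::
  "(omega1 \<Rightarrow> omega1 set) \<Rightarrow> (omega1 \<Rightarrow> complex) \<Rightarrow> omega1 \<Rightarrow> omega1 \<Rightarrow> complex" where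
  "o_fun C z \<alpha> \<beta> = z \<alpha> ^ (osc C \<alpha> \<beta> + 1)"

definition w_fun ::
  "(omega1 \<Rightarrow> omega1 set) \<Rightarrow> (omega1 \<Rightarrow> complex) \<Rightarrow> omega1 \<Rightarrow> omega1 \<Rightarrow> complex" where
  "w_fun C z \<beta> \<alpha> = (if \<alpha> < \<beta> then o_fun C z \<alpha> \<beta> else 1)"

definition moore_space ::
  "(omega1 \<Rightarrow> omega1 set) \<Rightarrow> (omega1 \<Rightarrow> complex) \<Rightarrow> (omega1 \<Rightarrow> complex) topology" where
  "moore_space C z =
     subtopology (product_topology (\<lambda>_. top_of_set circle) UNIV) (range (w_fun C z))"

text \<open>A function with domain \<open>\<gamma>\<close> is a partial map defined exactly on
  \<^term>\<open>{..<\<gamma>}\<close>; for such maps, end-extension is map inclusion \<^const>\<open>map_le\<close>.\<close>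

definition tree_of ::
  "(omega1 \<Rightarrow> omega1 set) \<Rightarrow> (omega1 \<Rightarrow> complex) \<Rightarrow> (omega1 \<rightharpoonup> complex) set" where
  "tree_of C z = {(Some \<circ> w_fun C z \<beta>) |` {..<\<gamma>} | \<beta> \<gamma>. \<gamma> \<le> \<beta>}"

definition special :: "'a set \<Rightarrow> ('a \<Rightarrow> 'a \<Rightarrow> bool) \<Rightarrow> bool" where
  "special T le \<longleftrightarrow>
     (\<exists>A :: nat \<Rightarrow> 'a set. T = (\<Union>n. A n) \<and>
        (\<forall>n. \<forall>s\<in>A n. \<forall>t\<in>A n. s \<noteq> t \<longrightarrow> \<not> le s t \<and> \<not> le t s))"

definition Delta_space :: "'a topology \<Rightarrow> bool" where
  "Delta_space X \<longleftrightarrow>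
     (\<forall>D :: nat \<Rightarrow> 'a set.
        (\<forall>n. D n \<subseteq> topspace X) \<and> decseq D \<and> (\<Inter>n. D n) = {} \<longrightarrow>
        (\<exists>U :: nat \<Rightarrow> 'a set.
           (\<forall>n. openin X (U n)) \<and> decseq U \<and> (\<forall>n. D n \<subseteq> U n) \<and> (\<Inter>n. U n) = {}))"

unbundle no cardinal_syntax

end

theory Submission
  imports Defs
begin

text \<open>The reason why Moore's space has no chance to be a \<open>\<Delta>\<close>-space is that it is hereditarily
Lindeloef in a very strong sense, while \<open>w\<^sub>\<beta>\<close> and \<open>w\<^sub>\<beta>\<^sub>+\<^sub>1\<close> agree below \<open>\<beta>\<close>.

Write the tree \<open>T(o)\<close> as a union of antichains \<open>A\<^sub>n\<close>, let \<open>idx \<gamma>\<close> be an index of an antichain that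
contains the node \<open>w\<^sub>\<gamma> \<restriction> \<gamma>\<close>, and let \<open>D\<^sub>n\<close> be the set of all \<open>w\<^sub>\<gamma>\<close> with \<open>idx \<gamma> \<ge> n\<close>.  These sets decrease
to the empty set.  Suppose that decreasing open sets \<open>U\<^sub>n \<supseteq> D\<^sub>n\<close> had empty intersection.  Then for some \<open>n\<close> there
are uncountably many \<open>\<beta>\<close> with \<open>w\<^sub>\<beta> \<notin> U\<^sub>n\<close>.  Walking down from \<open>\<beta> + 1\<close> starts with the step to \<open>\<beta>\<close>, which
changes neither the lower trace nor the functions \<open>e\<close>; hence the nodes of \<open>\<beta>, \<beta> + 1, \<beta> + 2, \<dots>\<close> form
a chain, their indices are pairwise distinct, and \<open>w\<^sub>\<beta>\<^sub>+\<^sub>j \<in> D\<^sub>n \<subseteq> U\<^sub>n\<close> for some \<open>j\<close> (lemma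
\<open>w_fun_osuc\<close>).  So a basic neighbourhood of \<open>w\<^sub>\<beta>\<^sub>+\<^sub>j\<close>, given by a finite set of coordinates, misses every
\<open>w\<^sub>\<beta>\<^sub>'\<close> with \<open>w\<^sub>\<beta>\<^sub>' \<notin> U\<^sub>n\<close>, although \<open>w\<^sub>\<beta>\<^sub>+\<^sub>j\<close> agrees with \<open>w\<^sub>\<beta>\<close> below \<open>\<beta>\<close>.  Lemma \<open>w_fun_approximates\<close> says
that this is impossible: it produces two of these ordinals \<open>\<beta>\<close>, \<open>\<beta>'\<close> such that \<open>w\<^sub>\<beta>\<^sub>'\<close> lies in the
neighbourhood belonging to \<open>\<beta>\<close>.

That lemma is the heart of the matter.  The coordinates below a suitable ordinal can be made the same
for uncountably many \<open>\<beta>\<close>, and there the values agree up to a small error.  At the remaining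
coordinates \<open>\<alpha>\<^sub>1, \<dots>, \<alpha>\<^sub>k\<close>, arbitrary points of the circle have to be approximated by
\<open>z\<^sub>\<alpha>\<close> raised to the power \<open>osc(\<alpha>, \<beta>') + 1\<close>.  By Kronecker's theorem some common shift \<open>m \<le> N\<close> of any
given exponents achieves this, and by Moore's oscillation theorem (\<open>oscillation_theorem\<close>) there are
\<open>\<beta>'\<close> for which the exponents are shifted by exactly \<open>m\<close>, for all \<open>m \<le> N\<close> simultaneously.

The oscillation theorem is proved by reflection at one well-chosen ordinal \<open>\<delta>\<close>, which plays the role
of the intersection of a countable elementary submodel with \<open>\<omega>\<^sub>1\<close>.  Above \<open>\<delta>\<close>, the lower trace from \<open>\<delta>\<close> is
prolonged by a piece on which all relevant values of \<open>e\<close> are equal, then by a piece on which the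
first function is larger (\<open>extend_equal\<close>, \<open>extend_greater\<close>); each such pair adds exactly one
oscillation.  Finally the first family is reflected to a member below \<open>\<delta>\<close>, and lower traces through
\<open>\<delta>\<close> concatenate (\<open>L_append\<close>).\<close>

section \<open>Unbounded sets of countable ordinals and reflection\<close>

definition unbounded :: "omega1 set \<Rightarrow> bool" where
  "unbounded S \<longleftrightarrow> (\<forall>\<eta>. \<exists>\<zeta>\<in>S. \<eta> < \<zeta>)"

lemma unboundedE:
  assumes "unbounded S"
  obtains \<zeta> where "\<zeta> \<in> S" "\<eta> < \<zeta>"
  using assms by (auto simp: unbounded_def)

lemma unbounded_UNIV: "unbounded UNIV"
  unfolding unbounded_def using less_osuc by blast

lemma countable_atMost_omega1: "countable {..\<alpha> :: omega1}"
proof -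
  have "{..\<alpha>} = {..<osuc \<alpha>}" by (auto simp: less_osuc_iff)
  then show ?thesis by (simp only: countable_lessThan_omega1)
qed

lemma countable_bounded:
  assumes "countable (A :: omega1 set)"
  obtains \<eta> where "\<And>x. x \<in> A \<Longrightarrow> x < \<eta>"
proof -
  have "countable (\<Union>x\<in>A. {..x})"
    using assms countable_atMost_omega1 by (rule countable_UN)
  then have "(\<Union>x\<in>A. {..x}) \<noteq> UNIV"
    using uncountable_omega1 by (intro notI) simp
  then obtain \<eta> where "\<And>x. x \<in> A \<Longrightarrow> \<not> \<eta> \<le> x" by blast
  then show thesis
    by (intro that[of \<eta>]) (simp add: not_le)
qed

lemma unbounded_cover_countable:
  assumes "unbounded S" "S \<subseteq> (\<Union>c\<in>K. T c)" "countable K"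
  obtains c where "c \<in> K" "unbounded (S \<inter> T c)"
proof (rule ccontr)
  assume neg: "\<not> thesis"
  have "\<exists>\<eta>. \<forall>\<zeta>\<in>S \<inter> T c. \<zeta> \<le> \<eta>" if c: "c \<in> K" for c
  proof -
    have "\<not> unbounded (S \<inter> T c)" 
      using neg \<open>\<And>c. \<lbrakk>c \<in> K; unbounded (S \<inter> T c)\<rbrakk> \<Longrightarrow> thesis\<close> c by blast
    then show ?thesis by (auto simp: unbounded_def not_less)
  qed
  then have "\<forall>c\<in>K. \<exists>\<eta>. \<forall>\<zeta>\<in>S \<inter> T c. \<zeta> \<le> \<eta>" by blast
  then obtain b where b: "\<forall>c\<in>K. \<forall>\<zeta>\<in>S \<inter> T c. \<zeta> \<le> b c"
    unfolding bchoice_iff by blast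
  obtain \<eta> where \<eta>: "\<And>x. x \<in> b ` K \<Longrightarrow> x < \<eta>"
    using countable_bounded[OF countable_image[OF assms(3), of b]] by blast
  obtain \<zeta> where "\<zeta> \<in> S" "\<eta> < \<zeta>"
    using assms(1) by (rule unboundedE)
  moreover then obtain c where "c \<in> K" "\<zeta> \<in> T c"
    using assms(2) by blast
  ultimately show False
    using b \<eta>[of "b c"] by (meson IntI imageI leD less_trans le_less_trans)
qed

lemma unbounded_pigeonhole:
  fixes f :: "omega1 \<Rightarrow> 'c::countable"
  assumes "unbounded S"
  obtains c where "unbounded {\<zeta> \<in> S. f \<zeta> = c}"
proof -
  have "S \<subseteq> (\<Union>c\<in>UNIV. {\<zeta>. f \<zeta> = c})" by auto
  then show thesis
  proof (rule unbounded_cover_countable[OF assms])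
    show "countable (UNIV :: 'c set)" by simp
    fix c assume "unbounded (S \<inter> {\<zeta>. f \<zeta> = c})"
    then show thesis
      by (intro that[of c]) (simp add: Collect_conj_eq)
  qed
qed

text \<open>Closing off under countably many witnesses at a time gives an ordinal \<open>\<delta>\<close> that behaves like
\<open>M \<inter> \<omega>\<^sub>1\<close> for a countable elementary submodel \<open>M\<close>: \<^term>\<open>F \<gamma>\<close> lists the sets that are definable from
parameters in \<open>\<gamma>\<close>.  The alternative in the conclusion is used mostly in the form that a listed set
which contains \<open>\<delta>\<close>, or an ordinal above it, is unbounded both in \<open>\<omega>\<^sub>1\<close> and in \<open>\<delta>\<close>.\<close>

lemma reflection:
  fixes F :: "omega1 \<Rightarrow> omega1 set set"
  assumes "\<And>\<gamma>. countable (F \<gamma>)"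
  obtains \<delta> where
    "\<exists>\<eta>. \<eta> < \<delta>" "\<And>\<eta>. \<eta> < \<delta> \<Longrightarrow> \<exists>\<eta>'. \<eta> < \<eta>' \<and> \<eta>' < \<delta>"
    "\<And>\<gamma> S. \<gamma> < \<delta> \<Longrightarrow> S \<in> F \<gamma> \<Longrightarrow>
       (\<exists>\<eta><\<delta>. \<forall>\<zeta>\<in>S. \<zeta> < \<eta>) \<or> unbounded S \<and> (\<forall>\<eta><\<delta>. \<exists>\<zeta>\<in>S. \<eta> < \<zeta> \<and> \<zeta> < \<delta>)"
proof -
  \<comment> \<open>For unbounded \<open>S\<close> a member of \<open>S\<close> above \<open>\<eta>\<close>, for bounded \<open>S\<close> an upper bound of \<open>S\<close>.\<close>
  define h where "h \<eta> S = (if unbounded S then SOME \<zeta>. \<zeta> \<in> S \<and> \<eta> < \<zeta> else SOME \<eta>. \<forall>\<zeta>\<in>S. \<zeta> \<le> \<eta>)"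
    for \<eta> and S :: "omega1 set"
  have h1: "h \<eta> S \<in> S \<and> \<eta> < h \<eta> S" if "unbounded S" for \<eta> S
    using that someI_ex[of "\<lambda>\<zeta>. \<zeta> \<in> S \<and> \<eta> < \<zeta>"] unfolding h_def unbounded_def by auto
  have h2: "\<zeta> \<le> h \<eta> S" if "\<not> unbounded S" "\<zeta> \<in> S" for \<eta> \<zeta> S
  proof -
    have "\<exists>\<eta>. \<forall>\<zeta>\<in>S. \<zeta> \<le> \<eta>"
      using that(1) by (auto simp: unbounded_def not_less)
    from someI_ex[OF this] that show ?thesis by (simp add: h_def)
  qed
  have "\<exists>\<eta>'. \<eta> < \<eta>' \<and> (\<forall>\<gamma>\<le>\<eta>. \<forall>S\<in>F \<gamma>. h \<eta> S < \<eta>')" for \<eta>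
  proof -
    have "countable (insert \<eta> (\<Union>\<gamma>\<in>{..\<eta>}. h \<eta> ` F \<gamma>))"
      using assms countable_atMost_omega1 by (intro countable_insert countable_UN countable_image) auto
    then obtain \<eta>' where \<eta>': "\<And>x. x \<in> insert \<eta> (\<Union>\<gamma>\<in>{..\<eta>}. h \<eta> ` F \<gamma>) \<Longrightarrow> x < \<eta>'"
      using countable_bounded by blast
    then show ?thesis
      by (intro exI[of _ \<eta>']) auto
  qed
  then obtain g where g: "\<And>\<eta>. \<eta> < g \<eta>" "\<And>\<eta> \<gamma> S. \<gamma> \<le> \<eta> \<Longrightarrow> S \<in> F \<gamma> \<Longrightarrow> h \<eta> S < g \<eta>"
    by metis
  define d where "d n = (g ^^ n) 0" for n :: nat
  have d_Suc: "d (Suc n) = g (d n)" for n by (simp add: d_def)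
  define \<delta> where "\<delta> = (LEAST \<delta>. \<forall>n. d n < \<delta>)"
  have "\<exists>\<delta>. \<forall>n. d n < \<delta>"
    using countable_bounded[of "range d"] by (metis countableI_type countable_image rangeI)
  then have d_less: "d n < \<delta>" for n
    unfolding \<delta>_def by (rule LeastI2_ex) auto
  have cofinal: "\<exists>n. \<eta> \<le> d n" if "\<eta> < \<delta>" for \<eta>
    using not_less_Least[of \<eta> "\<lambda>\<delta>. \<forall>n. d n < \<delta>"] that by (auto simp: \<delta>_def not_less)
  have mono: "d m \<le> d n" if "m \<le> n" for m n
    by (rule lift_Suc_mono_le[OF _ that]) (simp add: d_Suc less_imp_le[OF g(1)])
  show thesis
  proof
    show "\<exists>\<eta>. \<eta> < \<delta>" using d_less by blast
    show "\<exists>\<eta>'. \<eta> < \<eta>' \<and> \<eta>' < \<delta>" if \<eta>: "\<eta> < \<delta>" for \<eta>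
    proof -
      obtain n where "\<eta> \<le> d n" using cofinal[OF \<eta>] by blast
      then have "\<eta> < d (Suc n)" using g(1)[of "d n"] by (simp add: d_Suc)
      then show ?thesis using d_less by blast
    qed
    fix \<gamma> S assume "\<gamma> < \<delta>" and S: "S \<in> F \<gamma>"
    then obtain n where n: "\<gamma> \<le> d n" using cofinal by blast
    show "(\<exists>\<eta><\<delta>. \<forall>\<zeta>\<in>S. \<zeta> < \<eta>) \<or> unbounded S \<and> (\<forall>\<eta><\<delta>. \<exists>\<zeta>\<in>S. \<eta> < \<zeta> \<and> \<zeta> < \<delta>)"
    proof (cases "unbounded S")
      case True
      have "\<exists>\<zeta>\<in>S. \<eta> < \<zeta> \<and> \<zeta> < \<delta>" if \<eta>: "\<eta> < \<delta>" for \<eta>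
      proof -
        obtain m where m: "\<eta> \<le> d m" using cofinal[OF \<eta>] by blast
        let ?k = "max m n"
        have "h (d ?k) S < d (Suc ?k)"
          unfolding d_Suc by (rule g(2)[OF order_trans[OF n mono] S]) simp
        moreover have "\<eta> < h (d ?k) S"
          using h1[OF True, of "d ?k"] order_trans[OF m mono[of m ?k]] by (auto intro: le_less_trans)
        moreover have "h (d ?k) S \<in> S"
          using h1[OF True] by blast
        ultimately show ?thesis
          using d_less less_trans by blast
      qed
      with True show ?thesis by blast
    next
      case False
      have "\<forall>\<zeta>\<in>S. \<zeta> < d (Suc n)"
        using h2[OF False] le_less_trans[OF _ g(2)[OF n S]] unfolding d_Suc by blast
      then show ?thesis using d_less by blast
    qed
  qed
qed

lemma limit_finite_bounded:
  fixes \<delta> :: omega1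
  assumes "\<exists>\<eta>. \<eta> < \<delta>" "\<And>\<eta>. \<eta> < \<delta> \<Longrightarrow> \<exists>\<eta>'. \<eta> < \<eta>' \<and> \<eta>' < \<delta>" "finite A" "A \<subseteq> {..<\<delta>}"
  obtains \<gamma> where "\<gamma> < \<delta>" "A \<subseteq> {..<\<gamma>}"
proof (cases "A = {}")
  case True
  then show thesis using assms(1) that by auto
next
  case False
  then have "Max A < \<delta>" using assms(3,4) Max_in by blast
  then obtain \<gamma> where "Max A < \<gamma>" "\<gamma> < \<delta>" using assms(2) by blast
  then show thesis using that[of \<gamma>] assms(3) by (auto intro: le_less_trans[OF Max_ge])
qed

section \<open>The functions \<open>e\<close> are finite-to-one and coherent\<close>

locale walks =
  fixes C :: "omega1 \<Rightarrow> omega1 set"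
  assumes C_seq: "C_sequence C"
begin

abbreviation "step \<equiv> walk_step C"
abbreviation "L \<equiv> lower_trace C"
abbreviation "e \<equiv> e_fun C"

lemma step_in: "\<alpha> < \<beta> \<Longrightarrow> step \<alpha> \<beta> \<in> C \<beta>"
  and step_ge: "\<alpha> < \<beta> \<Longrightarrow> \<alpha> \<le> step \<alpha> \<beta>"
  using LeastI_ex[OF C_sequence_cofinal[OF C_seq]] by (auto simp: walk_step_def not_less)

lemma step_le: "c \<in> C \<beta> \<Longrightarrow> \<alpha> \<le> c \<Longrightarrow> step \<alpha> \<beta> \<le> c"
  unfolding walk_step_def by (rule Least_le) auto

lemmas step_less = walk_step_less[OF C_seq]
lemmas C_less = subsetD[OF C_sequence_subset[OF C_seq], unfolded lessThan_iff]
lemmas C_finite = C_sequence_finite[OF C_seq]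

lemma C_Int_step: "\<alpha> < \<beta> \<Longrightarrow> C \<beta> \<inter> {..<\<alpha>} = C \<beta> \<inter> {..<step \<alpha> \<beta>}"
  using step_le step_ge by (fastforce simp: not_less[symmetric])

text \<open>The case \<open>step \<alpha> \<beta> = \<alpha>\<close> is separate because the walk ends there: \<^term>\<open>e_fun C \<alpha> \<alpha>\<close> is a maximum over
the empty set.\<close>

lemma e_rec:
  assumes "\<alpha> < \<beta>"
  shows "e \<beta> \<alpha> = (if step \<alpha> \<beta> = \<alpha> then card (C \<beta> \<inter> {..<\<alpha>})
                 else max (card (C \<beta> \<inter> {..<\<alpha>})) (e (step \<alpha> \<beta>) \<alpha>))"
proof -
  have img: "e \<beta> \<alpha> = Max ((\<lambda>\<xi>. card (C \<xi> \<inter> {..<\<alpha>})) ` upper_trace C \<alpha> \<beta>)" for \<beta>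
    unfolding e_fun_def by (rule arg_cong[of _ _ Max]) auto
  show ?thesis
  proof (cases "step \<alpha> \<beta> = \<alpha>")
    case True
    then show ?thesis
      by (simp add: img upper_trace_rec[OF C_seq assms] upper_trace_refl)
  next
    case False
    then have "\<alpha> < step \<alpha> \<beta>" using step_ge[OF assms] by simp
    then have "upper_trace C \<alpha> (step \<alpha> \<beta>) \<noteq> {}"
      by (simp add: upper_trace_rec[OF C_seq])
    with False show ?thesis
      by (simp add: img upper_trace_rec[OF C_seq assms] finite_upper_trace max.commute)
  qed
qed

lemma e_step:
  assumes "\<alpha> < \<beta>"
  shows "card (C \<beta> \<inter> {..<step \<alpha> \<beta>}) \<le> e \<beta> \<alpha>"
    and "step \<alpha> \<beta> = \<alpha> \<or> \<alpha> < step \<alpha> \<beta> \<and>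
           e \<beta> \<alpha> = max (card (C \<beta> \<inter> {..<step \<alpha> \<beta>})) (e (step \<alpha> \<beta>) \<alpha>)"
  unfolding C_Int_step[OF assms, symmetric]
  using e_rec[OF assms] step_ge[OF assms] by (cases "step \<alpha> \<beta> = \<alpha>"; simp)+

lemma C_index_inj:
  assumes "c \<in> C \<beta>" "d \<in> C \<beta>" "card (C \<beta> \<inter> {..<c}) = card (C \<beta> \<inter> {..<d})"
  shows "c = d"
proof -
  have "card (C \<beta> \<inter> {..<x}) < card (C \<beta> \<inter> {..<y})" if "x \<in> C \<beta>" "y \<in> C \<beta>" "x < y" for x y
    using that by (intro psubset_card_mono C_finite C_less) auto
  with assms show ?thesis by (metis less_irrefl neq_iff)
qed

text \<open>If \<^term>\<open>e \<beta> \<alpha> \<le> n\<close>, the first step of the walk goes to one of the first \<open>n + 1\<close> elements of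
\<^term>\<open>C \<beta>\<close>, and the induction hypothesis applies to each of these finitely many ordinals.\<close>

lemma e_finite_to_one: "finite {\<alpha>. \<alpha> < \<beta> \<and> e \<beta> \<alpha> \<le> n}"
proof (induction \<beta> rule: less_induct)
  case (less \<beta>)
  define D where "D = {c \<in> C \<beta>. card (C \<beta> \<inter> {..<c}) \<le> n}"
  have "finite D"
  proof (rule inj_on_finite)
    show "inj_on (\<lambda>c. card (C \<beta> \<inter> {..<c})) D"
      using C_index_inj by (auto simp: D_def inj_on_def)
    show "(\<lambda>c. card (C \<beta> \<inter> {..<c})) ` D \<subseteq> {..n}" by (auto simp: D_def)
  qed simp
  have "{\<alpha>. \<alpha> < \<beta> \<and> e \<beta> \<alpha> \<le> n} \<subseteq> (\<Union>c\<in>D. insert c {\<alpha>. \<alpha> < c \<and> e c \<alpha> \<le> n})"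
  proof
    fix \<alpha> assume "\<alpha> \<in> {\<alpha>. \<alpha> < \<beta> \<and> e \<beta> \<alpha> \<le> n}"
    then have \<alpha>: "\<alpha> < \<beta>" "e \<beta> \<alpha> \<le> n" by auto
    then have "step \<alpha> \<beta> \<in> D"
      using step_in[OF \<alpha>(1)] e_step(1)[OF \<alpha>(1)] by (simp add: D_def)
    moreover have "\<alpha> \<in> insert (step \<alpha> \<beta>) {\<alpha>'. \<alpha>' < step \<alpha> \<beta> \<and> e (step \<alpha> \<beta>) \<alpha>' \<le> n}"
      using \<alpha>(2) e_step(2)[OF \<alpha>(1)] by auto
    ultimately show "\<alpha> \<in> (\<Union>c\<in>D. insert c {\<alpha>. \<alpha> < c \<and> e c \<alpha> \<le> n})" by blast
  qed
  moreover have "finite (\<Union>c\<in>D. insert c {\<alpha>. \<alpha> < c \<and> e c \<alpha> \<le> n})"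
    using \<open>finite D\<close> less C_less by (auto simp: D_def)
  ultimately show ?case by (rule finite_subset)
qed

text \<open>From \<open>\<gamma>\<close>, an \<open>\<alpha> < \<beta>\<close> is sent to one of finitely many \<open>c\<close>, namely an element of \<open>C \<gamma> \<inter> \<beta>\<close> or
\<open>step \<beta> \<gamma>\<close>.  For each \<open>c\<close>, the number \<^term>\<open>e \<gamma> \<alpha>\<close> is the maximum of a constant and \<^term>\<open>e c \<alpha>\<close>.  The
constant matters only finitely often because \<^term>\<open>e c\<close> is finite-to-one, and \<^term>\<open>e c\<close> agrees with
\<^term>\<open>e \<beta>\<close> almost everywhere by induction, since both ordinals are below \<open>\<gamma>\<close>.\<close>

lemma e_coherent_less:
  assumes "\<beta> < \<gamma>"
  shows "finite {\<alpha>. \<alpha> < \<beta> \<and> e \<beta> \<alpha> \<noteq> e \<gamma> \<alpha>}"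
  using assms
proof (induction \<gamma> arbitrary: \<beta> rule: less_induct)
  case (less \<gamma>)
  define D where "D = insert (step \<beta> \<gamma>) (C \<gamma> \<inter> {..<\<beta>})"
  have fD: "finite D" and DC: "D \<subseteq> C \<gamma>"
    using C_finite[OF less.prems] step_in[OF less.prems] by (auto simp: D_def)
  have fin_c: "finite {\<alpha>. \<alpha> < c \<and> \<alpha> < \<beta> \<and> e c \<alpha> \<noteq> e \<beta> \<alpha>}" if "c \<in> D" for c
  proof -
    have "c < \<gamma>" using that DC C_less by blast
    then show ?thesis
      using less.IH[of c \<beta>] less.IH[of \<beta> c] less.prems
      by (cases rule: linorder_cases[of c \<beta>]) (auto elim: finite_subset[rotated])
  qed
  let ?B = "\<lambda>c. insert c ({\<alpha>. \<alpha> < c \<and> e c \<alpha> \<le> card (C \<gamma> \<inter> {..<c})} \<union>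
                  {\<alpha>. \<alpha> < c \<and> \<alpha> < \<beta> \<and> e c \<alpha> \<noteq> e \<beta> \<alpha>})"
  have "{\<alpha>. \<alpha> < \<beta> \<and> e \<beta> \<alpha> \<noteq> e \<gamma> \<alpha>} \<subseteq> (\<Union>c\<in>D. ?B c)"
  proof
    fix \<alpha> assume "\<alpha> \<in> {\<alpha>. \<alpha> < \<beta> \<and> e \<beta> \<alpha> \<noteq> e \<gamma> \<alpha>}"
    then have \<alpha>: "\<alpha> < \<beta>" "e \<beta> \<alpha> \<noteq> e \<gamma> \<alpha>" "\<alpha> < \<gamma>" using less.prems by auto
    let ?c = "step \<alpha> \<gamma>"
    have "?c \<in> D"
    proof (cases "?c < \<beta>")
      case False
      then have "step \<beta> \<gamma> \<le> ?c" using step_le step_in \<alpha>(3) by simp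
      moreover have "?c \<le> step \<beta> \<gamma>"
        using step_le[OF step_in[OF less.prems]] step_ge[OF less.prems] \<alpha>(1) by simp
      ultimately show ?thesis by (simp add: D_def)
    qed (use step_in \<alpha>(3) in \<open>auto simp: D_def\<close>)
    moreover have "\<alpha> \<in> ?B ?c"
      using \<alpha>(1,2) e_step(2)[OF \<alpha>(3)] by (auto simp: max_def split: if_splits)
    ultimately show "\<alpha> \<in> (\<Union>c\<in>D. ?B c)" by blast
  qed
  moreover have "finite (\<Union>c\<in>D. ?B c)"
    using fD fin_c e_finite_to_one by (intro finite_UN_I finite.insertI finite_UnI) auto
  ultimately show ?case by (rule finite_subset)
qed

lemma e_coherent:
  assumes "\<delta> \<le> \<beta>" "\<delta> \<le> \<beta>'"
  shows "finite {\<xi>. \<xi> < \<delta> \<and> e \<beta> \<xi> \<noteq> e \<beta>' \<xi>}"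
proof -
  have "finite {\<xi>. \<xi> < \<delta> \<and> e \<delta> \<xi> \<noteq> e \<beta> \<xi>}" if "\<delta> \<le> \<beta>" for \<beta>
    using that e_coherent_less[of \<delta> \<beta>] by (cases "\<delta> = \<beta>") auto
  from this[OF assms(1)] this[OF assms(2)] show ?thesis
    by (rule finite_subset[rotated, OF finite_UnI]) auto
qed

text \<open>A level of the Aronszajn tree of the functions \<open>e\<close>.  It is countable because, by coherence, its members
are finite modifications of a single function.\<close>

definition level :: "omega1 \<Rightarrow> (omega1 \<Rightarrow> nat) set" where
  "level \<gamma> = (\<lambda>\<beta>. restrict (e \<beta>) {..<\<gamma>}) ` {\<gamma>..}"

lemma countable_level: "countable (level \<gamma>)"
proof -
  let ?K = "{D. finite D \<and> D \<subseteq> {..<\<gamma>}}"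
  let ?f = "\<lambda>(D, g). restrict (\<lambda>\<xi>. if \<xi> \<in> D then g \<xi> else e \<gamma> \<xi>) {..<\<gamma>}"
  have "level \<gamma> \<subseteq> ?f ` (SIGMA D:?K. D \<rightarrow>\<^sub>E (UNIV :: nat set))"
  proof
    fix s assume "s \<in> level \<gamma>"
    then obtain \<beta> where \<beta>: "\<gamma> \<le> \<beta>" "s = restrict (e \<beta>) {..<\<gamma>}" by (auto simp: level_def)
    let ?D = "{\<xi>. \<xi> < \<gamma> \<and> e \<beta> \<xi> \<noteq> e \<gamma> \<xi>}"
    have "finite ?D" using e_coherent[OF \<beta>(1) order_refl] .
    then have "(?D, restrict (e \<beta>) ?D) \<in> (SIGMA D:?K. D \<rightarrow>\<^sub>E (UNIV :: nat set))" by auto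
    moreover have "s = ?f (?D, restrict (e \<beta>) ?D)" using \<beta>(2) by (auto simp: fun_eq_iff)
    ultimately show "s \<in> ?f ` (SIGMA D:?K. D \<rightarrow>\<^sub>E (UNIV :: nat set))" by blast
  qed
  moreover have "countable (SIGMA D:?K. D \<rightarrow>\<^sub>E (UNIV :: nat set))"
    by (intro countable_SIGMA countable_Collect_finite_subset countable_lessThan_omega1 countable_PiE) auto
  ultimately show ?thesis by (meson countable_image countable_subset)
qed

section \<open>Concatenation of lower traces\<close>

lemma L_nonempty_ge:
  assumes "\<alpha> < \<beta>" "c \<in> C \<beta>" "c < \<alpha>"
  shows "L \<alpha> \<beta> \<noteq> {} \<and> (\<forall>\<xi>\<in>L \<alpha> \<beta>. c \<le> \<xi>)"
proof -
  have "c \<le> Max (C \<beta> \<inter> {..<\<alpha>})" "C \<beta> \<inter> {..<\<alpha>} \<noteq> {}"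
    using assms C_finite[OF assms(1)] by auto
  then show ?thesis
    by (auto simp: lower_trace_rec[OF C_seq assms(1)])
qed

text \<open>The hypotheses force the walk from \<open>\<gamma>\<close> to \<open>\<alpha>\<close> to follow the walk from \<open>\<gamma>\<close> to \<open>\<beta>\<close> until it reaches \<open>\<beta>\<close>: an
element of some \<open>C\<close> on the way in the interval from \<open>\<alpha>\<close> to \<open>\<beta>\<close> would put an ordinal above or equal to
\<open>\<alpha>\<close> into \<open>L \<beta> \<gamma>\<close>.\<close>

lemma L_append:
  assumes "\<alpha> \<le> \<beta>" "\<beta> \<le> \<gamma>" "\<And>\<xi>. \<xi> \<in> L \<beta> \<gamma> \<Longrightarrow> \<xi> < \<alpha>"
    "\<And>\<xi> \<eta>. \<xi> \<in> L \<beta> \<gamma> \<Longrightarrow> \<eta> \<in> L \<alpha> \<beta> \<Longrightarrow> \<xi> < \<eta>"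
  shows "L \<alpha> \<gamma> = L \<beta> \<gamma> \<union> L \<alpha> \<beta>"
  using assms(2-)
proof (induction \<gamma> rule: less_induct)
  case (less \<gamma>)
  show ?case
  proof (cases "\<beta> = \<gamma>")
    case True
    then show ?thesis by (simp add: lower_trace_refl)
  next
    case False
    then have bg: "\<beta> < \<gamma>" and ag: "\<alpha> < \<gamma>" using less.prems assms(1) by auto
    let ?m = "Max (C \<gamma> \<inter> {..<\<beta>})"
    have m_in: "?m \<in> C \<gamma> \<inter> {..<\<beta>}" and m_L: "?m \<in> L \<beta> \<gamma>" if "C \<gamma> \<inter> {..<\<beta>} \<noteq> {}"
      using that Max_in[OF C_finite[OF bg]] by (auto simp: lower_trace_rec[OF C_seq bg])
    have m_max: "c \<le> ?m" if "c \<in> C \<gamma>" "c < \<beta>" for c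
      using that C_finite[OF bg] by simp
    have eqC: "C \<gamma> \<inter> {..<\<alpha>} = C \<gamma> \<inter> {..<\<beta>}"
      using less.prems(2)[OF m_L] m_max assms(1) by force
    have eqs: "step \<alpha> \<gamma> = step \<beta> \<gamma>"
    proof (rule antisym)
      show "step \<alpha> \<gamma> \<le> step \<beta> \<gamma>"
        using step_le[OF step_in[OF bg]] step_ge[OF bg] assms(1) by simp
      have "\<beta> \<le> step \<alpha> \<gamma>"
        using eqC step_in[OF ag] step_ge[OF ag] by (auto simp: set_eq_iff not_less[symmetric])
      then show "step \<beta> \<gamma> \<le> step \<alpha> \<gamma>" using step_le[OF step_in[OF ag]] by simp
    qed
    let ?s = "step \<beta> \<gamma>"
    have cover: "\<exists>\<xi>'\<in>L \<beta> \<gamma>. \<xi> \<le> \<xi>'" if \<xi>: "\<xi> \<in> L \<beta> ?s" for \<xi>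
    proof (cases "C \<gamma> \<inter> {..<\<beta>} \<noteq> {} \<and> \<xi> < ?m")
      case True
      then show ?thesis using m_L less_imp_le by blast
    next
      case False
      then have "\<xi> \<in> L \<beta> \<gamma>" using \<xi> by (auto simp: lower_trace_rec[OF C_seq bg])
      then show ?thesis by blast
    qed
    have IH: "L \<alpha> ?s = L \<beta> ?s \<union> L \<alpha> \<beta>"
    proof (rule less.IH[OF step_less[OF bg] step_ge[OF bg]])
      show "\<xi> < \<alpha>" if "\<xi> \<in> L \<beta> ?s" for \<xi>
        using cover[OF that] less.prems(2) le_less_trans by blast
      show "\<xi> < \<eta>" if "\<xi> \<in> L \<beta> ?s" "\<eta> \<in> L \<alpha> \<beta>" for \<xi> \<eta>
        using cover[OF that(1)] less.prems(3)[OF _ that(2)] le_less_trans by blast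
    qed
    show ?thesis
    proof (cases "C \<gamma> \<inter> {..<\<beta>} = {}")
      case True
      then show ?thesis
        by (simp add: lower_trace_rec[OF C_seq bg] lower_trace_rec[OF C_seq ag] eqs eqC IH)
    next
      case False
      then have "L \<alpha> \<beta> \<inter> {..<?m} = {}"
        using less.prems(3)[OF m_L] by fastforce
      with False show ?thesis
        by (auto simp: lower_trace_rec[OF C_seq bg] lower_trace_rec[OF C_seq ag] eqs eqC IH)
    qed
  qed
qed

end

section \<open>Counting oscillations along a finite set\<close>

definition osc_on :: "omega1 set \<Rightarrow> (omega1 \<Rightarrow> nat) \<Rightarrow> (omega1 \<Rightarrow> nat) \<Rightarrow> nat" where
  "osc_on L f g =
     card {\<zeta> \<in> L - {Min L}. f (pred_in L \<zeta>) \<le> g (pred_in L \<zeta>) \<and> g \<zeta> < f \<zeta>}"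

lemma osc_eq_osc_on: "osc C \<alpha> \<beta> = osc_on (lower_trace C \<alpha> \<beta>) (e_fun C \<alpha>) (e_fun C \<beta>)"
  by (simp add: osc_def osc_on_def Let_def)

lemma pred_in_mem:
  assumes "finite L" "\<zeta> \<in> L - {Min L}"
  shows "pred_in L \<zeta> \<in> L"
proof -
  have "L \<noteq> {}" using assms by auto
  then have "Min L \<in> {\<eta> \<in> L. \<eta> < \<zeta>}"
    using assms Min_in[of L] Min_le[of L \<zeta>] by (auto simp: less_le)
  then show ?thesis
    unfolding pred_in_def using Max_in[of "{\<eta> \<in> L. \<eta> < \<zeta>}"] assms(1) by auto
qed

lemma osc_on_cong:
  assumes "finite L" "\<And>\<xi>. \<xi> \<in> L \<Longrightarrow> f \<xi> = f' \<xi>" "\<And>\<xi>. \<xi> \<in> L \<Longrightarrow> g \<xi> = g' \<xi>"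
  shows "osc_on L f g = osc_on L f' g'"
proof -
  have "f (pred_in L \<zeta>) = f' (pred_in L \<zeta>)" "g (pred_in L \<zeta>) = g' (pred_in L \<zeta>)"
    if "\<zeta> \<in> L - {Min L}" for \<zeta>
    using pred_in_mem[OF assms(1) that] assms(2,3) by auto
  then show ?thesis
    unfolding osc_on_def using assms(2,3) by (intro arg_cong[where f = card]) auto
qed

lemma osc_on_le_0:
  assumes "\<And>\<xi>. \<xi> \<in> L \<Longrightarrow> f \<xi> \<le> g \<xi>"
  shows "osc_on L f g = 0"
  unfolding osc_on_def using assms by (force simp: card_eq_0_iff not_less[symmetric])

lemma osc_on_gt_0:
  assumes "finite L" "\<And>\<xi>. \<xi> \<in> L \<Longrightarrow> g \<xi> < f \<xi>"
  shows "osc_on L f g = 0"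
proof -
  have "{\<zeta> \<in> L - {Min L}. f (pred_in L \<zeta>) \<le> g (pred_in L \<zeta>) \<and> g \<zeta> < f \<zeta>} = {}"
    using assms(2)[OF pred_in_mem[OF assms(1)]] by (auto simp: not_le)
  then show ?thesis by (simp only: osc_on_def card.empty)
qed

lemma Max_union:
  fixes A B :: "omega1 set"
  assumes "finite A" "finite B" "B \<noteq> {}" "\<And>x y. x \<in> A \<Longrightarrow> y \<in> B \<Longrightarrow> x < y"
  shows "Max (A \<union> B) = Max B"
proof (rule Max_eqI)
  show "y \<le> Max B" if "y \<in> A \<union> B" for y
    using that assms(2) less_imp_le[OF assms(4)[OF _ Max_in[OF assms(2,3)]]] by auto
qed (use assms in auto)

text \<open>Besides the oscillations inside the two blocks, only the transition from the last element of the
first block to the first element of the second one can contribute.\<close>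

lemma osc_on_append:
  assumes "finite L" "L \<noteq> {}" "finite M" "M \<noteq> {}" "\<And>\<xi> \<eta>. \<xi> \<in> L \<Longrightarrow> \<eta> \<in> M \<Longrightarrow> \<xi> < \<eta>"
  shows "osc_on (L \<union> M) f g = osc_on L f g
    + (if f (Max L) \<le> g (Max L) \<and> g (Min M) < f (Min M) then 1 else 0) + osc_on M f g"
proof -
  let ?P = "\<lambda>S \<zeta>. f (pred_in S \<zeta>) \<le> g (pred_in S \<zeta>) \<and> g \<zeta> < f \<zeta>"
  let ?A = "{\<zeta> \<in> L - {Min L}. ?P L \<zeta>}" and ?B = "{\<zeta> \<in> M - {Min M}. ?P M \<zeta>}"
  let ?J = "if f (Max L) \<le> g (Max L) \<and> g (Min M) < f (Min M) then {Min M} else {}"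
  have mn: "Min L \<in> L" "Max L \<in> L" "Min M \<in> M" using assms by auto
  have M_le: "Min M \<le> \<eta>" if "\<eta> \<in> M" for \<eta> using assms(3) that by simp
  have disj: "L \<inter> M = {}" using assms(5) by blast
  have Min_Un: "Min (L \<union> M) = Min L"
    using less_imp_le[OF assms(5)[OF mn(1,3)]]
    by (simp only: Min_Un[OF assms(1-4)] min_absorb1)
  have pL: "pred_in (L \<union> M) \<zeta> = pred_in L \<zeta>" if "\<zeta> \<in> L" for \<zeta>
  proof -
    have "{\<eta> \<in> L \<union> M. \<eta> < \<zeta>} = {\<eta> \<in> L. \<eta> < \<zeta>}"
      using assms(5)[OF that] less_asym by blast
    then show ?thesis by (simp only: pred_in_def)
  qed
  have pJ: "pred_in (L \<union> M) (Min M) = Max L"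
  proof -
    have "{\<eta> \<in> L \<union> M. \<eta> < Min M} = L"
      using assms(5)[OF _ mn(3)] M_le by (auto simp: not_less[symmetric])
    then show ?thesis by (simp only: pred_in_def)
  qed
  have pM: "pred_in (L \<union> M) \<zeta> = pred_in M \<zeta>" if "\<zeta> \<in> M - {Min M}" for \<zeta>
  proof -
    let ?M = "{\<eta> \<in> M. \<eta> < \<zeta>}"
    have "Min M \<in> ?M" using that M_le[of \<zeta>] mn(3) by auto
    then have M: "finite ?M" "?M \<noteq> {}" using assms(3) by auto
    have "{\<eta> \<in> L \<union> M. \<eta> < \<zeta>} = L \<union> ?M" using assms(5) that by auto
    moreover have "Max (L \<union> ?M) = Max ?M"
    proof -
      have "Max L < Max ?M" using assms(5)[OF mn(2)] Max_in[OF M] by simp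
      then show ?thesis by (simp only: Max_Un[OF assms(1,2) M] max_absorb2[OF less_imp_le])
    qed
    ultimately show ?thesis by (simp only: pred_in_def)
  qed
  have "{\<zeta> \<in> L \<union> M - {Min (L \<union> M)}. ?P (L \<union> M) \<zeta>} = ?A \<union> ?J \<union> ?B"
  proof -
    have "\<zeta> \<in> {\<zeta> \<in> L \<union> M - {Min (L \<union> M)}. ?P (L \<union> M) \<zeta>} \<longleftrightarrow> \<zeta> \<in> ?A \<union> ?J \<union> ?B" for \<zeta>
    proof -
      consider "\<zeta> \<notin> L \<union> M" | "\<zeta> \<in> L" | "\<zeta> = Min M" | "\<zeta> \<in> M - {Min M}" by blast
      then show ?thesis
      proof cases
        case 1
        then show ?thesis using mn(3) by auto
      next
        case 2
        then show ?thesis using disj pL[OF 2] Min_Un mn(3) by auto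
      next
        case 3
        then show ?thesis using disj pJ Min_Un mn by auto
      next
        case 4
        then show ?thesis using disj pM[OF 4] Min_Un mn by auto
      qed
    qed
    then show ?thesis by blast
  qed
  moreover have "card (?A \<union> ?J \<union> ?B) = card ?A + card ?J + card ?B"
  proof -
    have "?J \<subseteq> {Min M}" by simp
    then have J: "(?A \<union> ?J) \<inter> ?B = {}" "?A \<inter> ?J = {}" "finite ?J"
      using disj mn(3) finite_subset[of ?J "{Min M}"] by blast+
    have fin: "finite ?A" "finite ?B" using assms(1,3) by auto
    show ?thesis
      using card_Un_disjoint[OF finite_UnI[OF fin(1) J(3)] fin(2) J(1)]
        card_Un_disjoint[OF fin(1) J(3) J(2)] by simp
  qed
  ultimately show ?thesis by (simp add: osc_on_def)
qed

section \<open>Reflecting pairs of families at a single ordinal\<close>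

text \<open>The two uncountable families of the oscillation theorem, indexed by \<open>\<omega>\<^sub>1\<close>: a family of \<open>k\<close>-tuples
and a family of ordinals.  Uncountability and pairwise disjointness take the form of the
condition that the members with index \<open>\<nu>\<close> are not below \<open>\<nu>\<close>, which survives replacing every index by a
larger one.\<close>

locale families = walks +
  fixes k :: nat and a :: "omega1 \<Rightarrow> nat \<Rightarrow> omega1" and b :: "omega1 \<Rightarrow> omega1"
  assumes a_ge: "\<And>\<nu> i. i < k \<Longrightarrow> \<nu> \<le> a \<nu> i" and b_ge: "\<And>\<nu>. \<nu> \<le> b \<nu>"
begin

text \<open>For \<open>\<rho>\<close> outside of \<open>stubborn T\<close>, the functions \<open>e\<close> of arbitrarily late tuples with index in \<open>T\<close> can be made
as large as desired on any given finite set above \<open>\<rho>\<close>.\<close>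

definition stubborn :: "omega1 set \<Rightarrow> omega1 set" where
  "stubborn T = {\<rho>. \<exists>X \<eta> m. finite X \<and> X \<subseteq> {\<rho>..} \<and>
     (\<forall>\<nu>\<in>T. \<eta> \<le> \<nu> \<longrightarrow> (\<exists>i<k. \<exists>\<xi>\<in>X. e (a \<nu> i) \<xi> \<le> m))}"

text \<open>Otherwise infinitely many disjoint finite sets would, with the same bound \<open>c\<close>, obstruct one tuple
above all of them.  One of the finitely many functions of this tuple would then be at most \<open>c\<close> infinitely
often, although it is finite-to-one.\<close>

lemma stubborn_bounded:
  assumes T: "unbounded T"
  shows "\<not> unbounded (stubborn T)"
proof
  assume unb: "unbounded (stubborn T)"
  have "\<exists>X \<eta> m. X \<subseteq> {\<rho>..<\<eta>} \<and> (\<forall>\<nu>\<in>T. \<eta> \<le> \<nu> \<longrightarrow> (\<exists>i<k. \<exists>\<xi>\<in>X. e (a \<nu> i) \<xi> \<le> m))" for \<rho>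
  proof -
    obtain \<rho>' where "\<rho>' \<in> stubborn T" "\<rho> < \<rho>'"
      using unb by (rule unboundedE)
    then obtain X \<eta> m where X: "finite X" "X \<subseteq> {\<rho>..}"
      "\<And>\<nu>. \<nu> \<in> T \<Longrightarrow> \<eta> \<le> \<nu> \<Longrightarrow> \<exists>i<k. \<exists>\<xi>\<in>X. e (a \<nu> i) \<xi> \<le> m"
      by (fastforce simp: stubborn_def)
    obtain \<eta>' where \<eta>': "\<And>x. x \<in> insert \<eta> X \<Longrightarrow> x < \<eta>'"
      using countable_bounded[of "insert \<eta> X"] X(1) by (auto simp: countable_finite)
    have "\<exists>i<k. \<exists>\<xi>\<in>X. e (a \<nu> i) \<xi> \<le> m" if "\<nu> \<in> T" "\<eta>' \<le> \<nu>" for \<nu>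
      using X(3)[OF that(1)] \<eta>'[of \<eta>] that(2) by simp
    moreover have "X \<subseteq> {\<rho>..<\<eta>'}" using X(2) \<eta>' by auto
    ultimately show ?thesis by blast
  qed
  then obtain X \<eta> m where X: "\<And>\<rho>. X \<rho> \<subseteq> {\<rho>..<\<eta> \<rho>}"
    and low: "\<And>\<rho> \<nu>. \<nu> \<in> T \<Longrightarrow> \<eta> \<rho> \<le> \<nu> \<Longrightarrow> \<exists>i<k. \<exists>\<xi>\<in>X \<rho>. e (a \<nu> i) \<xi> \<le> m \<rho>"
    by metis
  obtain c where c: "unbounded {\<rho> \<in> UNIV. m \<rho> = c}"
    using unbounded_pigeonhole[OF unbounded_UNIV] .
  \<comment> \<open>The obstructing sets of the \<open>r j\<close> lie in consecutive intervals.\<close>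
  have "\<exists>r. \<forall>j::nat. m (r j) = c \<and> \<eta> (r j) \<le> r (Suc j)"
  proof (rule dependent_nat_choice)
    show "\<exists>\<rho>. m \<rho> = c" using unboundedE[OF c] by blast
    show "\<exists>\<rho>'. m \<rho>' = c \<and> \<eta> \<rho> \<le> \<rho>'" for \<rho>
    proof -
      obtain \<rho>' where "\<rho>' \<in> {\<rho> \<in> UNIV. m \<rho> = c}" "\<eta> \<rho> < \<rho>'"
        using c by (rule unboundedE)
      then show ?thesis by (intro exI[of _ \<rho>']) simp
    qed
  qed
  then obtain r where r: "\<And>j::nat. m (r j) = c" "\<And>j. \<eta> (r j) \<le> r (Suc j)" by blast
  obtain \<theta> where \<theta>: "\<And>j. \<eta> (r j) < \<theta>"
    using countable_bounded[of "range (\<lambda>j. \<eta> (r j))"] by (meson countableI_type countable_image rangeI)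
  obtain \<nu> where \<nu>: "\<nu> \<in> T" "\<theta> < \<nu>" using T by (rule unboundedE)
  have "\<exists>\<xi>\<in>X (r j). \<exists>i<k. e (a \<nu> i) \<xi> \<le> c" for j
    using low[OF \<nu>(1), of "r j"] \<theta>[of j] \<nu>(2) r(1)[of j] by fastforce
  then obtain x where x: "\<And>j. x j \<in> X (r j)" "\<And>j. \<exists>i<k. e (a \<nu> i) (x j) \<le> c" by metis
  have x_bounds: "r j \<le> x j" "x j < \<eta> (r j)" for j
    using x(1)[of j] X[of "r j"] by auto
  have "x j < x (Suc j)" for j
    using x_bounds(2)[of j] r(2)[of j] x_bounds(1)[of "Suc j"] by simp
  then have "inj x" by (intro strict_mono_imp_inj_on) (simp add: strict_mono_Suc_iff)
  moreover have "range x \<subseteq> (\<Union>i<k. {\<xi>. \<xi> < a \<nu> i \<and> e (a \<nu> i) \<xi> \<le> c})"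
  proof
    fix \<xi> assume "\<xi> \<in> range x"
    then obtain j where j: "\<xi> = x j" by blast
    then have "\<xi> < \<nu>" using x_bounds(2)[of j] \<theta>[of j] \<nu>(2) by simp
    moreover obtain i where "i < k" "e (a \<nu> i) \<xi> \<le> c" using x(2)[of j] j by blast
    ultimately show "\<xi> \<in> (\<Union>i<k. {\<xi>. \<xi> < a \<nu> i \<and> e (a \<nu> i) \<xi> \<le> c})"
      using less_le_trans[OF _ a_ge[of i \<nu>]] by blast
  qed
  moreover have "finite (\<Union>i<k. {\<xi>. \<xi> < a \<nu> i \<and> e (a \<nu> i) \<xi> \<le> c})"
    using e_finite_to_one by blast
  ultimately show False
    using finite_imageD[of x UNIV] finite_subset by blast
qed

text \<open>The codes record the functions \<open>e\<close> of the members with a given index, restricted to \<open>\<gamma>\<close>.  Indices not below \<open>\<gamma>\<close>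
have only countably many codes, which may therefore serve as parameters of reflected sets.\<close>

definition acode :: "omega1 \<Rightarrow> omega1 \<Rightarrow> nat \<Rightarrow> omega1 \<Rightarrow> nat" where
  "acode \<gamma> \<nu> = (\<lambda>i\<in>{..<k}. restrict (e (a \<nu> i)) {..<\<gamma>})"

definition bcode :: "omega1 \<Rightarrow> omega1 \<Rightarrow> omega1 \<Rightarrow> nat" where
  "bcode \<gamma> \<mu> = restrict (e (b \<mu>)) {..<\<gamma>}"

lemma acode_eqD: "acode \<gamma> \<nu>' = acode \<gamma> \<nu> \<Longrightarrow> i < k \<Longrightarrow> \<xi> < \<gamma> \<Longrightarrow> e (a \<nu>' i) \<xi> = e (a \<nu> i) \<xi>"
  by (drule fun_cong[of _ _ i], drule fun_cong[of _ _ \<xi>]) (simp add: acode_def)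

lemma bcode_eqD: "bcode \<gamma> \<mu>' = bcode \<gamma> \<mu> \<Longrightarrow> \<xi> < \<gamma> \<Longrightarrow> e (b \<mu>') \<xi> = e (b \<mu>) \<xi>"
  by (drule fun_cong[of _ _ \<xi>]) (simp add: bcode_def)

lemma acode_in: "\<gamma> \<le> \<nu> \<Longrightarrow> acode \<gamma> \<nu> \<in> {..<k} \<rightarrow>\<^sub>E level \<gamma>"
  unfolding acode_def level_def by (auto intro!: imageI order_trans[OF _ a_ge])

lemma bcode_in: "\<gamma> \<le> \<mu> \<Longrightarrow> bcode \<gamma> \<mu> \<in> level \<gamma>"
  using b_ge[of \<mu>] by (force simp: bcode_def level_def)

text \<open>When \<open>s\<close>, \<open>t\<close> and \<open>F \<subseteq> \<gamma>\<close> are the codes and the lower trace belonging to a tuple and an ordinal above some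
\<open>\<delta>\<close>, with \<open>\<gamma>\<close> so large that all their functions \<open>e\<close> coincide between \<open>\<gamma>\<close> and \<open>\<delta>\<close>, these are the ordinals
that cannot be distinguished from \<open>\<delta>\<close> with parameters below \<open>\<gamma>\<close>.\<close>

definition alike :: "omega1 \<Rightarrow> (nat \<Rightarrow> omega1 \<Rightarrow> nat) \<Rightarrow> (omega1 \<Rightarrow> nat) \<Rightarrow> omega1 set \<Rightarrow> omega1 set" where
  "alike \<gamma> s t F = {\<zeta>. \<exists>\<nu> \<mu>. \<zeta> \<le> \<nu> \<and> \<zeta> < \<mu> \<and> acode \<gamma> \<nu> = s \<and> bcode \<gamma> \<mu> = t \<and> L \<zeta> (b \<mu>) = F \<and>
     (\<forall>i<k. \<forall>\<xi>. \<gamma> \<le> \<xi> \<longrightarrow> \<xi> < \<zeta> \<longrightarrow> e (a \<nu> i) \<xi> = e (b \<mu>) \<xi>)}"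

text \<open>When \<open>\<zeta>\<close> is the reflecting ordinal, \<open>L \<zeta> \<delta>\<close> is the piece by which lower traces down to \<open>\<zeta>\<close> are prolonged; it
has to be nonempty, and to lie above the part that is already controlled.\<close>

definition linked :: "omega1 \<Rightarrow> omega1 set \<Rightarrow> omega1 set" where
  "linked \<gamma> Z = {\<zeta>. \<exists>\<delta>\<in>Z. \<zeta> < \<delta> \<and> L \<zeta> \<delta> \<noteq> {} \<and> L \<zeta> \<delta> \<subseteq> {\<gamma>..}}"

text \<open>Reflecting the initial segments makes \<open>\<delta>\<close> closed under the tuples, and the bounded sets of stubborn ordinals
obtain bounds below \<open>\<delta>\<close>.  For the codes, and for the ordinals that are alike but not linked, the other
alternative of reflection is needed: members at or above \<open>\<delta>\<close> have counterparts below \<open>\<delta>\<close>.\<close>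

definition test_sets :: "omega1 \<Rightarrow> omega1 set set" where
  "test_sets \<gamma> =
     (let K = {..<k} \<rightarrow>\<^sub>E level \<gamma> in
       (\<lambda>i. {..a \<gamma> i}) ` {..<k} \<union> (\<lambda>s. {\<nu>. acode \<gamma> \<nu> = s}) ` K \<union>
       (\<lambda>s. stubborn {\<nu>. acode \<gamma> \<nu> = s}) ` K \<union>
       (\<lambda>(s, t, F). alike \<gamma> s t F - linked \<gamma> (alike \<gamma> s t F)) `
         (K \<times> level \<gamma> \<times> {F. finite F \<and> F \<subseteq> {..<\<gamma>}}))"

lemma countable_test_sets: "countable (test_sets \<gamma>)"
proof -
  have "countable ({..<k} \<rightarrow>\<^sub>E level \<gamma>)"
    by (intro countable_PiE countable_level) simp
  then show ?thesis
    unfolding test_sets_def Let_def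
    by (intro countable_Un countable_image countable_SIGMA countable_level
        countable_Collect_finite_subset countable_lessThan_omega1) auto
qed

end

locale reflection_point = families +
  fixes \<delta> :: omega1
  assumes delta_pos: "\<exists>\<eta>. \<eta> < \<delta>" and delta_limit: "\<And>\<eta>. \<eta> < \<delta> \<Longrightarrow> \<exists>\<eta>'. \<eta> < \<eta>' \<and> \<eta>' < \<delta>"
    and reflects: "\<And>\<gamma> S. \<gamma> < \<delta> \<Longrightarrow> S \<in> test_sets \<gamma> \<Longrightarrow>
       (\<exists>\<eta><\<delta>. \<forall>\<zeta>\<in>S. \<zeta> < \<eta>) \<or> unbounded S \<and> (\<forall>\<eta><\<delta>. \<exists>\<zeta>\<in>S. \<eta> < \<zeta> \<and> \<zeta> < \<delta>)"
begin

lemma finite_bounded: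
  assumes "finite A" "A \<subseteq> {..<\<delta>}"
  obtains \<gamma> where "\<gamma> < \<delta>" "A \<subseteq> {..<\<gamma>}"
  using limit_finite_bounded[OF delta_pos delta_limit assms] by blast

lemma a_less:
  assumes "\<nu> < \<delta>" "i < k"
  shows "a \<nu> i < \<delta>"
proof -
  have "{..a \<nu> i} \<in> test_sets \<nu>" using assms(2) by (simp add: test_sets_def Let_def)
  moreover have "\<not> unbounded {..a \<nu> i}" by (auto simp: unbounded_def not_less)
  ultimately show ?thesis using reflects[OF assms(1)] less_trans by blast
qed

lemma acode_reflects:
  assumes "\<gamma> < \<delta>" "\<delta> \<le> \<nu>"
  shows "unbounded {\<nu>'. acode \<gamma> \<nu>' = acode \<gamma> \<nu>}"
    and "\<eta> < \<delta> \<Longrightarrow> \<exists>\<nu>'. acode \<gamma> \<nu>' = acode \<gamma> \<nu> \<and> \<eta> < \<nu>' \<and> \<nu>' < \<delta>"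
proof -
  let ?S = "{\<nu>'. acode \<gamma> \<nu>' = acode \<gamma> \<nu>}"
  have "?S \<in> test_sets \<gamma>"
    using acode_in[of \<gamma> \<nu>] assms by (auto simp: test_sets_def Let_def)
  moreover have "\<not> (\<exists>\<eta><\<delta>. \<forall>\<zeta>\<in>?S. \<zeta> < \<eta>)" using assms(2) by force
  ultimately have *: "unbounded ?S \<and> (\<forall>\<eta><\<delta>. \<exists>\<zeta>\<in>?S. \<eta> < \<zeta> \<and> \<zeta> < \<delta>)"
    using reflects[OF assms(1)] by blast
  then show "unbounded ?S" by blast
  show "\<exists>\<nu>'. acode \<gamma> \<nu>' = acode \<gamma> \<nu> \<and> \<eta> < \<nu>' \<and> \<nu>' < \<delta>" if "\<eta> < \<delta>"
    using * that by blast
qed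

lemma coherent_above:
  assumes "\<gamma>0 < \<delta>" "\<delta> \<le> \<nu>" "\<delta> < \<mu>"
  obtains \<gamma> where "\<gamma>0 \<le> \<gamma>" "\<gamma> < \<delta>"
    "\<And>i \<xi>. i < k \<Longrightarrow> \<gamma> \<le> \<xi> \<Longrightarrow> \<xi> < \<delta> \<Longrightarrow> e (a \<nu> i) \<xi> = e (b \<mu>) \<xi>"
proof -
  let ?D = "\<Union>i<k. {\<xi>. \<xi> < \<delta> \<and> e (a \<nu> i) \<xi> \<noteq> e (b \<mu>) \<xi>}"
  have "finite (insert \<gamma>0 ?D)"
    using assms b_ge[of \<mu>] by (auto intro!: e_coherent order_trans[OF _ a_ge])
  then obtain \<gamma> where \<gamma>: "\<gamma> < \<delta>" "insert \<gamma>0 ?D \<subseteq> {..<\<gamma>}"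
    using finite_bounded[of "insert \<gamma>0 ?D"] assms(1) by auto
  show thesis
    by (rule that[of \<gamma>]) (use \<gamma> in \<open>auto simp: subset_iff not_less[symmetric]\<close>)
qed

text \<open>The ordinal \<open>\<delta>\<close> is alike to itself.  If it were not linked, then by reflection there would be ordinals
\<open>\<zeta> < \<delta>\<close>, arbitrarily close to \<open>\<delta>\<close>, that are alike but not linked; but such a \<open>\<zeta>\<close> is linked by \<open>\<delta>\<close>, since the
lower trace from \<open>\<delta>\<close> to \<open>\<zeta>\<close> lies above any given element of \<^term>\<open>C \<delta>\<close> below \<open>\<zeta>\<close>.  So some larger \<open>\<delta>'\<close> looks
like \<open>\<delta>\<close>, and its witnesses have the old lower trace at \<open>\<delta>'\<close> followed by \<open>L \<delta> \<delta>'\<close>.\<close>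

lemma extend_equal:
  assumes \<gamma>0: "\<gamma>0 < \<delta>" and \<nu>: "\<delta> \<le> \<nu>" and \<mu>: "\<delta> < \<mu>" and LF: "L \<delta> (b \<mu>) \<subseteq> {..<\<gamma>0}"
  obtains \<nu>' \<mu>' M where "\<delta> \<le> \<nu>'" "\<delta> < \<mu>'"
    "finite M" "M \<noteq> {}" "M \<subseteq> {\<gamma>0..<\<delta>}" "L \<delta> (b \<mu>') = L \<delta> (b \<mu>) \<union> M"
    "\<And>i \<xi>. i < k \<Longrightarrow> \<xi> < \<gamma>0 \<Longrightarrow> e (a \<nu>' i) \<xi> = e (a \<nu> i) \<xi>"
    "\<And>\<xi>. \<xi> < \<gamma>0 \<Longrightarrow> e (b \<mu>') \<xi> = e (b \<mu>) \<xi>"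
    "\<And>i \<xi>. i < k \<Longrightarrow> \<xi> \<in> M \<Longrightarrow> e (a \<nu>' i) \<xi> = e (b \<mu>') \<xi>"
proof -
  obtain \<gamma> where \<gamma>: "\<gamma>0 \<le> \<gamma>" "\<gamma> < \<delta>"
    "\<And>i \<xi>. i < k \<Longrightarrow> \<gamma> \<le> \<xi> \<Longrightarrow> \<xi> < \<delta> \<Longrightarrow> e (a \<nu> i) \<xi> = e (b \<mu>) \<xi>"
    using coherent_above[OF \<gamma>0 \<nu> \<mu>] by blast
  let ?F = "L \<delta> (b \<mu>)"
  let ?Z = "alike \<gamma> (acode \<gamma> \<nu>) (bcode \<gamma> \<mu>) ?F"
  let ?Y = "?Z - linked \<gamma> ?Z"
  have Fg: "?F \<subseteq> {..<\<gamma>}" using LF \<gamma>(1) by auto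
  have "?Y \<in> test_sets \<gamma>"
    using acode_in[of \<gamma> \<nu>] bcode_in[of \<gamma> \<mu>] Fg \<gamma>(2) \<nu> \<mu> finite_lower_trace
    unfolding test_sets_def Let_def by (intro UnI2 rev_image_eqI[of "(acode \<gamma> \<nu>, bcode \<gamma> \<mu>, ?F)"]) auto
  have dZ: "\<delta> \<in> ?Z" using \<nu> \<mu> \<gamma>(3) by (auto simp: alike_def)
  have "\<delta> \<in> linked \<gamma> ?Z"
  proof (rule ccontr)
    assume "\<delta> \<notin> linked \<gamma> ?Z"
    then have "\<delta> \<in> ?Y" using dZ by blast
    then have "\<forall>\<eta><\<delta>. \<exists>\<zeta>\<in>?Y. \<eta> < \<zeta> \<and> \<zeta> < \<delta>"
      using reflects[OF \<gamma>(2) \<open>?Y \<in> test_sets \<gamma>\<close>] less_asym by blast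
    moreover obtain c where c: "c \<in> C \<delta>" "\<gamma> \<le> c"
      using C_sequence_cofinal[OF C_seq \<gamma>(2)] by (auto simp: not_less)
    ultimately obtain \<zeta> where \<zeta>: "\<zeta> \<in> ?Y" "c < \<zeta>" "\<zeta> < \<delta>"
      using C_less by blast
    have "L \<zeta> \<delta> \<noteq> {} \<and> L \<zeta> \<delta> \<subseteq> {\<gamma>..}"
      using L_nonempty_ge[OF \<zeta>(3) c(1) \<zeta>(2)] c(2) by force
    then have "\<zeta> \<in> linked \<gamma> ?Z" using dZ \<zeta>(3) unfolding linked_def by blast
    then show False using \<zeta>(1) by blast
  qed
  then obtain \<delta>' where \<delta>': "\<delta>' \<in> ?Z" "\<delta> < \<delta>'" "L \<delta> \<delta>' \<noteq> {}" "L \<delta> \<delta>' \<subseteq> {\<gamma>..}"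
    by (auto simp: linked_def)
  from \<delta>'(1) obtain \<nu>' \<mu>' where w: "\<delta>' \<le> \<nu>'" "\<delta>' < \<mu>'" "acode \<gamma> \<nu>' = acode \<gamma> \<nu>" "bcode \<gamma> \<mu>' = bcode \<gamma> \<mu>"
    "L \<delta>' (b \<mu>') = ?F"
    "\<And>i \<xi>. i < k \<Longrightarrow> \<gamma> \<le> \<xi> \<Longrightarrow> \<xi> < \<delta>' \<Longrightarrow> e (a \<nu>' i) \<xi> = e (b \<mu>') \<xi>"
    unfolding alike_def by blast
  have sub: "L \<delta> \<delta>' \<subseteq> {\<gamma>..<\<delta>}"
    using \<delta>'(4) lower_trace_subset[OF C_seq, of \<delta> \<delta>'] by auto
  show thesis
  proof (rule that[of \<nu>' \<mu>' "L \<delta> \<delta>'"])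
    show "\<delta> \<le> \<nu>'" "\<delta> < \<mu>'" using \<delta>'(2) w(1,2) by auto
    show "finite (L \<delta> \<delta>')" "L \<delta> \<delta>' \<noteq> {}" using \<delta>'(3) finite_lower_trace by auto
    show "L \<delta> \<delta>' \<subseteq> {\<gamma>0..<\<delta>}" using sub \<gamma>(1) by force
    show "L \<delta> (b \<mu>') = ?F \<union> L \<delta> \<delta>'"
      unfolding w(5)[symmetric]
    proof (rule L_append)
      show "\<delta> \<le> \<delta>'" using \<delta>'(2) by simp
      show "\<delta>' \<le> b \<mu>'" using w(2) b_ge[of \<mu>'] by simp
      show "\<xi> < \<delta>" if "\<xi> \<in> L \<delta>' (b \<mu>')" for \<xi>
        using that Fg \<gamma>(2) unfolding w(5) by force
      show "\<xi> < \<eta>" if "\<xi> \<in> L \<delta>' (b \<mu>')" "\<eta> \<in> L \<delta> \<delta>'" for \<xi> \<eta>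
        using that Fg sub unfolding w(5) by force
    qed
    show "e (a \<nu>' i) \<xi> = e (a \<nu> i) \<xi>" if "i < k" "\<xi> < \<gamma>0" for i \<xi>
      using acode_eqD[OF w(3) that(1), of \<xi>] that(2) \<gamma>(1) by simp
    show "e (b \<mu>') \<xi> = e (b \<mu>) \<xi>" if "\<xi> < \<gamma>0" for \<xi>
      using bcode_eqD[OF w(4), of \<xi>] that \<gamma>(1) by simp
    show "e (a \<nu>' i) \<xi> = e (b \<mu>') \<xi>" if "i < k" "\<xi> \<in> L \<delta> \<delta>'" for i \<xi>
      using w(6)[OF that(1), of \<xi>] that(2) sub \<delta>'(2) by force
  qed
qed

text \<open>As in \<open>extend_equal\<close>, but the tuple is exchanged afterwards: above a bound of the stubborn ordinals, a
later tuple with the same code has functions that exceed those of \<open>b \<mu>'\<close> on the whole new piece.\<close>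

lemma extend_greater:
  assumes \<gamma>0: "\<gamma>0 < \<delta>" and \<nu>: "\<delta> \<le> \<nu>" and \<mu>: "\<delta> < \<mu>" and LF: "L \<delta> (b \<mu>) \<subseteq> {..<\<gamma>0}"
  obtains \<nu>' \<mu>' M where "\<delta> \<le> \<nu>'" "\<delta> < \<mu>'"
    "finite M" "M \<noteq> {}" "M \<subseteq> {\<gamma>0..<\<delta>}" "L \<delta> (b \<mu>') = L \<delta> (b \<mu>) \<union> M"
    "\<And>i \<xi>. i < k \<Longrightarrow> \<xi> < \<gamma>0 \<Longrightarrow> e (a \<nu>' i) \<xi> = e (a \<nu> i) \<xi>"
    "\<And>\<xi>. \<xi> < \<gamma>0 \<Longrightarrow> e (b \<mu>') \<xi> = e (b \<mu>) \<xi>"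
    "\<And>i \<xi>. i < k \<Longrightarrow> \<xi> \<in> M \<Longrightarrow> e (b \<mu>') \<xi> < e (a \<nu>' i) \<xi>"
proof -
  let ?T = "{\<nu>'. acode \<gamma>0 \<nu>' = acode \<gamma>0 \<nu>}"
  have "stubborn ?T \<in> test_sets \<gamma>0"
    using acode_in[of \<gamma>0 \<nu>] \<gamma>0 \<nu> by (auto simp: test_sets_def Let_def)
  then obtain \<rho> where \<rho>: "\<rho> < \<delta>" "\<forall>\<zeta>\<in>stubborn ?T. \<zeta> < \<rho>"
    using reflects[OF \<gamma>0] stubborn_bounded[OF acode_reflects(1)[OF \<gamma>0 \<nu>]] by blast
  then have not_stubborn: "\<rho> \<notin> stubborn ?T" by blast
  have "max \<gamma>0 \<rho> < \<delta>" "L \<delta> (b \<mu>) \<subseteq> {..<max \<gamma>0 \<rho>}"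
    using \<gamma>0 \<rho>(1) LF by (auto simp: less_max_iff_disj)
  then show thesis
  proof (rule extend_equal[OF _ \<nu> \<mu>])
    fix \<nu>1 \<mu>' M
    assume 1: "\<delta> < \<mu>'" "finite M" "M \<noteq> {}" "M \<subseteq> {max \<gamma>0 \<rho>..<\<delta>}"
      "L \<delta> (b \<mu>') = L \<delta> (b \<mu>) \<union> M"
      "\<And>\<xi>. \<xi> < max \<gamma>0 \<rho> \<Longrightarrow> e (b \<mu>') \<xi> = e (b \<mu>) \<xi>"
    have "M \<subseteq> {\<rho>..}" using 1(4) by auto
    with not_stubborn 1(2)
    have "\<not> (\<forall>\<nu>'\<in>?T. \<delta> \<le> \<nu>' \<longrightarrow> (\<exists>i<k. \<exists>\<xi>\<in>M. e (a \<nu>' i) \<xi> \<le> Max (e (b \<mu>') ` M)))"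
      unfolding stubborn_def by blast
    then obtain \<nu>' where \<nu>': "acode \<gamma>0 \<nu>' = acode \<gamma>0 \<nu>" "\<delta> \<le> \<nu>'"
      "\<And>i \<xi>. i < k \<Longrightarrow> \<xi> \<in> M \<Longrightarrow> Max (e (b \<mu>') ` M) < e (a \<nu>' i) \<xi>"
      by (auto simp: not_le)
    show thesis
    proof (rule that[of \<nu>' \<mu>' M])
      show "M \<subseteq> {\<gamma>0..<\<delta>}" using 1(4) by auto
      show "e (a \<nu>' i) \<xi> = e (a \<nu> i) \<xi>" if "i < k" "\<xi> < \<gamma>0" for i \<xi>
        using acode_eqD[OF \<nu>'(1) that] .
      show "e (b \<mu>') \<xi> = e (b \<mu>) \<xi>" if "\<xi> < \<gamma>0" for \<xi>
        using 1(6) that by (simp add: less_max_iff_disj)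
      show "e (b \<mu>') \<xi> < e (a \<nu>' i) \<xi>" if "i < k" "\<xi> \<in> M" for i \<xi>
      proof -
        have "e (b \<mu>') \<xi> \<le> Max (e (b \<mu>') ` M)" using that(2) 1(2) by simp
        then show ?thesis using \<nu>'(3)[OF that] by simp
      qed
    qed (use 1 \<nu>'(2) in blast)+
  qed
qed

end

section \<open>Moore's oscillation theorem\<close>

context reflection_point
begin

text \<open>Since the final tuple will lie below \<open>\<delta>\<close>, only the part of its lower trace that comes from the walk down to
\<open>\<delta>\<close> can be controlled from above; \<open>osc_at\<close> counts the oscillations there.\<close>

abbreviation osc_at :: "omega1 \<Rightarrow> nat \<Rightarrow> omega1 \<Rightarrow> nat" where
  "osc_at \<nu> i \<mu> \<equiv> osc_on (L \<delta> (b \<mu>)) (e (a \<nu> i)) (e (b \<mu>))"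

text \<open>If the count ends at an element where the first function is larger, then prolonging the trace
downwards from \<open>\<delta>\<close> creates no oscillation at the junction.\<close>

definition ends_high :: "omega1 \<Rightarrow> omega1 \<Rightarrow> bool" where
  "ends_high \<nu> \<mu> \<longleftrightarrow> L \<delta> (b \<mu>) \<noteq> {} \<and>
     (\<forall>i<k. e (b \<mu>) (Max (L \<delta> (b \<mu>))) < e (a \<nu> i) (Max (L \<delta> (b \<mu>))))"

text \<open>A piece with equality followed by a piece with strict inequality adds exactly one oscillation, at the
least element of the second piece.  The tuple changes, but not its functions at the old
elements, so earlier counts are preserved.\<close>

lemma add_oscillation:
  assumes \<gamma>: "\<gamma> < \<delta>" and \<nu>: "\<delta> \<le> \<nu>" and \<mu>: "\<delta> < \<mu>" and LF: "L \<delta> (b \<mu>) \<subseteq> {..<\<gamma>}"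
    and ne: "L \<delta> (b \<mu>) \<noteq> {}"
  obtains \<nu>' \<mu>' where "\<delta> \<le> \<nu>'" "\<delta> < \<mu>'"
    "\<And>i \<xi>. i < k \<Longrightarrow> \<xi> < \<gamma> \<Longrightarrow> e (a \<nu>' i) \<xi> = e (a \<nu> i) \<xi>"
    "ends_high \<nu>' \<mu>'" "\<And>i. i < k \<Longrightarrow> osc_at \<nu>' i \<mu>' = osc_at \<nu> i \<mu> + 1"
proof (rule extend_equal[OF \<gamma> \<nu> \<mu> LF])
  fix \<nu>1 \<mu>1 M1
  assume 1: "\<delta> \<le> \<nu>1" "\<delta> < \<mu>1" "finite M1" "M1 \<noteq> {}" "M1 \<subseteq> {\<gamma>..<\<delta>}"
    "L \<delta> (b \<mu>1) = L \<delta> (b \<mu>) \<union> M1"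
    "\<And>i \<xi>. i < k \<Longrightarrow> \<xi> < \<gamma> \<Longrightarrow> e (a \<nu>1 i) \<xi> = e (a \<nu> i) \<xi>"
    "\<And>\<xi>. \<xi> < \<gamma> \<Longrightarrow> e (b \<mu>1) \<xi> = e (b \<mu>) \<xi>"
    "\<And>i \<xi>. i < k \<Longrightarrow> \<xi> \<in> M1 \<Longrightarrow> e (a \<nu>1 i) \<xi> = e (b \<mu>1) \<xi>"
  have "insert \<gamma> (L \<delta> (b \<mu>1)) \<subseteq> {..<\<delta>}"
    using \<gamma> lower_trace_subset[OF C_seq] by blast
  then obtain \<gamma>1 where \<gamma>1: "\<gamma>1 < \<delta>" "insert \<gamma> (L \<delta> (b \<mu>1)) \<subseteq> {..<\<gamma>1}"
    using finite_bounded[of "insert \<gamma> (L \<delta> (b \<mu>1))"] finite_lower_trace by auto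
  then have L1: "L \<delta> (b \<mu>1) \<subseteq> {..<\<gamma>1}" by simp
  show thesis
  proof (rule extend_greater[OF \<gamma>1(1) 1(1,2) L1])
    fix \<nu>2 \<mu>2 M2
    assume 2: "\<delta> \<le> \<nu>2" "\<delta> < \<mu>2" "finite M2" "M2 \<noteq> {}" "M2 \<subseteq> {\<gamma>1..<\<delta>}"
      "L \<delta> (b \<mu>2) = L \<delta> (b \<mu>1) \<union> M2"
      "\<And>i \<xi>. i < k \<Longrightarrow> \<xi> < \<gamma>1 \<Longrightarrow> e (a \<nu>2 i) \<xi> = e (a \<nu>1 i) \<xi>"
      "\<And>\<xi>. \<xi> < \<gamma>1 \<Longrightarrow> e (b \<mu>2) \<xi> = e (b \<mu>1) \<xi>"
      "\<And>i \<xi>. i < k \<Longrightarrow> \<xi> \<in> M2 \<Longrightarrow> e (b \<mu>2) \<xi> < e (a \<nu>2 i) \<xi>"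
    let ?L = "L \<delta> (b \<mu>)"
    have L2: "L \<delta> (b \<mu>2) = (?L \<union> M1) \<union> M2" using 1(6) 2(6) by simp
    have lt1: "\<xi> < \<eta>" if "\<xi> \<in> ?L" "\<eta> \<in> M1" for \<xi> \<eta>
      using that LF 1(5) by force
    have lt2: "\<xi> < \<eta>" if "\<xi> \<in> ?L \<union> M1" "\<eta> \<in> M2" for \<xi> \<eta>
      using that L1 1(6) 2(5) by force
    have fin: "finite ?L" by (rule finite_lower_trace)
    have below: "\<xi> < \<gamma>1" if "\<xi> \<in> ?L \<union> M1" for \<xi> using that L1 1(6) by auto
    have Max2: "Max (L \<delta> (b \<mu>2)) \<in> M2"
      unfolding L2 using Max_union[OF finite_UnI[OF fin 1(3)] 2(3,4) lt2] Max_in[OF 2(3,4)] by simp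
    show thesis
    proof (rule that[OF 2(1,2)])
      show "e (a \<nu>2 i) \<xi> = e (a \<nu> i) \<xi>" if "i < k" "\<xi> < \<gamma>" for i \<xi>
        using 2(7)[OF that(1), of \<xi>] 1(7)[OF that] that(2) \<gamma>1(2) less_trans by auto
      show "ends_high \<nu>2 \<mu>2"
        using 2(9) Max2 2(4) L2 by (auto simp: ends_high_def)
      fix i assume i: "i < k"
      let ?f = "e (a \<nu>2 i)" and ?g = "e (b \<mu>2)"
      have eq: "?f \<xi> = ?g \<xi>" if "\<xi> \<in> M1" for \<xi>
        using that 2(7)[OF i] 2(8) below 1(9)[OF i] by simp
      have gt: "?g \<xi> < ?f \<xi>" if "\<xi> \<in> M2" for \<xi> using 2(9)[OF i that] .
      have "osc_on ?L ?f ?g = osc_at \<nu> i \<mu>"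
      proof (rule osc_on_cong[OF fin])
        fix \<xi> assume "\<xi> \<in> ?L"
        then have "\<xi> < \<gamma>" "\<xi> < \<gamma>1" using LF below by auto
        then show "?f \<xi> = e (a \<nu> i) \<xi>" "?g \<xi> = e (b \<mu>) \<xi>"
          using 1(7,8) 2(7,8) i by simp_all
      qed
      moreover have "osc_on (?L \<union> M1) ?f ?g = osc_on ?L ?f ?g"
        using osc_on_append[OF fin ne 1(3,4) lt1] osc_on_le_0[of M1 ?f ?g] eq Min_in[OF 1(3,4)]
        by simp
      moreover have "Max (?L \<union> M1) \<in> M1"
        using Max_union[OF fin 1(3,4) lt1] Max_in[OF 1(3,4)] by simp
      ultimately show "osc_at \<nu>2 i \<mu>2 = osc_at \<nu> i \<mu> + 1"
        unfolding L2
        using osc_on_append[OF finite_UnI[OF fin 1(3)] _ 2(3,4) lt2, of ?f ?g] ne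
          osc_on_gt_0[OF 2(3), of ?g ?f] gt Min_in[OF 2(3,4)] eq
        by simp
    qed
  qed
qed

text \<open>The base case already uses \<open>extend_greater\<close> once, in order to have \<open>ends_high\<close> for the first ordinal too.\<close>

lemma oscillation_at:
  "\<exists>\<nu> \<mu>. \<delta> \<le> \<nu> \<and> (\<forall>m\<le>n. \<delta> < \<mu> m \<and> ends_high \<nu> (\<mu> m) \<and>
     (\<forall>i<k. osc_at \<nu> i (\<mu> m) = osc_at \<nu> i (\<mu> 0) + m))"
proof (induction n)
  case 0
  have sub: "L \<delta> (b (osuc \<delta>)) \<subseteq> {..<\<delta>}" by (rule lower_trace_subset[OF C_seq])
  obtain \<gamma> where \<gamma>: "\<gamma> < \<delta>" "L \<delta> (b (osuc \<delta>)) \<subseteq> {..<\<gamma>}"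
    using finite_bounded[OF finite_lower_trace sub] by blast
  show ?case
  proof (rule extend_greater[OF \<gamma>(1) order_refl less_osuc \<gamma>(2)])
    fix \<nu> \<mu> M
    assume 1: "\<delta> \<le> \<nu>" "\<delta> < \<mu>" "finite M" "M \<noteq> {}" "M \<subseteq> {\<gamma>..<\<delta>}"
      "L \<delta> (b \<mu>) = L \<delta> (b (osuc \<delta>)) \<union> M"
      "\<And>i \<xi>. i < k \<Longrightarrow> \<xi> \<in> M \<Longrightarrow> e (b \<mu>) \<xi> < e (a \<nu> i) \<xi>"
    have "Max (L \<delta> (b \<mu>)) = Max M"
      unfolding 1(6) using \<gamma>(2) 1(5) by (intro Max_union finite_lower_trace 1) force
    then have "ends_high \<nu> \<mu>"
      using 1(4,6,7) Max_in[OF 1(3,4)] by (auto simp: ends_high_def)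
    with 1(1,2) show ?case by (intro exI[of _ \<nu>] exI[of _ "\<lambda>_. \<mu>"]) simp
  qed
next
  case (Suc n)
  then obtain \<nu> \<mu> where \<nu>: "\<delta> \<le> \<nu>" and \<mu>: "\<And>m. m \<le> n \<Longrightarrow> \<delta> < \<mu> m"
    "\<And>m. m \<le> n \<Longrightarrow> ends_high \<nu> (\<mu> m)"
    "\<And>m i. m \<le> n \<Longrightarrow> i < k \<Longrightarrow> osc_at \<nu> i (\<mu> m) = osc_at \<nu> i (\<mu> 0) + m" by blast
  let ?A = "\<Union>m\<le>n. L \<delta> (b (\<mu> m))"
  have "finite ?A" "?A \<subseteq> {..<\<delta>}"
    using finite_lower_trace lower_trace_subset[OF C_seq] by blast+
  then obtain \<gamma> where \<gamma>: "\<gamma> < \<delta>" "?A \<subseteq> {..<\<gamma>}" by (rule finite_bounded)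
  have Ln: "L \<delta> (b (\<mu> n)) \<subseteq> {..<\<gamma>}" "L \<delta> (b (\<mu> n)) \<noteq> {}"
    using \<gamma>(2) \<mu>(2)[of n] by (auto simp: ends_high_def)
  show ?case
  proof (rule add_oscillation[OF \<gamma>(1) \<nu> \<mu>(1)[OF order_refl] Ln])
    fix \<nu>' \<mu>'
    assume 1: "\<delta> \<le> \<nu>'" "\<delta> < \<mu>'"
      "\<And>i \<xi>. i < k \<Longrightarrow> \<xi> < \<gamma> \<Longrightarrow> e (a \<nu>' i) \<xi> = e (a \<nu> i) \<xi>" "ends_high \<nu>' \<mu>'"
      "\<And>i. i < k \<Longrightarrow> osc_at \<nu>' i \<mu>' = osc_at \<nu> i (\<mu> n) + 1"
    have old: "\<xi> < \<gamma>" if "m \<le> n" "\<xi> \<in> L \<delta> (b (\<mu> m))" for m \<xi>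
      using that \<gamma>(2) by blast
    have osc_old: "osc_at \<nu>' i (\<mu> m) = osc_at \<nu> i (\<mu> m)" if "m \<le> n" "i < k" for m i
      using 1(3)[OF that(2)] old[OF that(1)] by (intro osc_on_cong finite_lower_trace) auto
    have high_old: "ends_high \<nu>' (\<mu> m)" if "m \<le> n" for m
      using \<mu>(2)[OF that] 1(3) old[OF that Max_in[OF finite_lower_trace]]
      by (auto simp: ends_high_def)
    let ?\<mu> = "\<mu>(Suc n := \<mu>')"
    have "\<delta> < ?\<mu> m \<and> ends_high \<nu>' (?\<mu> m) \<and> (\<forall>i<k. osc_at \<nu>' i (?\<mu> m) = osc_at \<nu>' i (?\<mu> 0) + m)"
      if "m \<le> Suc n" for m
    proof (cases "m = Suc n")
      case True
      then show ?thesis using 1(2,4,5) osc_old[of 0] \<mu>(3)[of n] by simp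
    next
      case False
      then have m: "m \<le> n" using that by simp
      then show ?thesis
        using \<mu>(1)[OF m] \<mu>(3)[OF m] high_old[OF m] osc_old[OF m] osc_old[of 0] False by simp
    qed
    with 1(1) show ?case by blast
  qed
qed

text \<open>The tuple above \<open>\<delta>\<close> is replaced by one just below \<open>\<delta>\<close> with the same functions below \<open>\<gamma>\<close>.  Its lower traces consist
of the controlled part and a common part in the interval from \<open>\<gamma>\<close> to \<open>\<delta>\<close>, on which the functions of all
\<open>b (\<mu> m)\<close> agree; hence the common part contributes the same number for each \<open>m\<close>.\<close>

lemma oscillation:
  "\<exists>\<nu> \<mu>. \<forall>m\<le>n. \<forall>i<k. a \<nu> i < b (\<mu> m) \<and>
     osc C (a \<nu> i) (b (\<mu> m)) = osc C (a \<nu> i) (b (\<mu> 0)) + m"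
proof -
  obtain \<nu> \<mu> where \<nu>: "\<delta> \<le> \<nu>" and \<mu>: "\<And>m. m \<le> n \<Longrightarrow> \<delta> < \<mu> m"
    "\<And>m. m \<le> n \<Longrightarrow> ends_high \<nu> (\<mu> m)"
    "\<And>m i. m \<le> n \<Longrightarrow> i < k \<Longrightarrow> osc_at \<nu> i (\<mu> m) = osc_at \<nu> i (\<mu> 0) + m"
    using oscillation_at[of n] by blast
  have b_gt: "\<delta> < b (\<mu> m)" if "m \<le> n" for m using \<mu>(1)[OF that] b_ge[of "\<mu> m"] by simp
  let ?A = "\<Union>m\<le>n. L \<delta> (b (\<mu> m)) \<union> {\<xi>. \<xi> < \<delta> \<and> e (b (\<mu> m)) \<xi> \<noteq> e (b (\<mu> 0)) \<xi>}"
  have "finite ?A"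
    using less_imp_le[OF b_gt] by (intro finite_UN_I finite_UnI finite_lower_trace e_coherent) auto
  moreover have "?A \<subseteq> {..<\<delta>}"
    using lower_trace_subset[OF C_seq] by blast
  ultimately obtain \<gamma> where \<gamma>: "\<gamma> < \<delta>" "?A \<subseteq> {..<\<gamma>}" by (rule finite_bounded)
  have low: "\<xi> < \<gamma>" if "m \<le> n" "\<xi> \<in> L \<delta> (b (\<mu> m))" for m \<xi>
    using that \<gamma>(2) by blast
  have agree: "e (b (\<mu> m)) \<xi> = e (b (\<mu> 0)) \<xi>" if "m \<le> n" "\<gamma> \<le> \<xi>" "\<xi> < \<delta>" for m \<xi>
  proof (rule ccontr)
    assume "e (b (\<mu> m)) \<xi> \<noteq> e (b (\<mu> 0)) \<xi>"
    then have "\<xi> \<in> {..<\<gamma>}" using that(1,3) \<gamma>(2) by blast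
    then show False using that(2) by simp
  qed
  obtain c where c: "c \<in> C \<delta>" "\<gamma> \<le> c"
    using C_sequence_cofinal[OF C_seq \<gamma>(1)] by (auto simp: not_less)
  obtain \<nu>' where \<nu>': "acode \<gamma> \<nu>' = acode \<gamma> \<nu>" "c < \<nu>'" "\<nu>' < \<delta>"
    using acode_reflects(2)[OF \<gamma>(1) \<nu> C_less[OF c(1)]] by blast
  \<comment> \<open>The last summand does not depend on \<open>m\<close>.\<close>
  have "a \<nu>' i < b (\<mu> m) \<and> osc C (a \<nu>' i) (b (\<mu> m)) =
      osc_at \<nu> i (\<mu> m) + osc_on (L (a \<nu>' i) \<delta>) (e (a \<nu>' i)) (e (b (\<mu> 0)))"
    if m: "m \<le> n" and i: "i < k" for m i
  proof -
    let ?\<alpha> = "a \<nu>' i" and ?\<beta> = "b (\<mu> m)"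
    let ?M = "L ?\<alpha> \<delta>"
    have \<alpha>: "?\<alpha> < \<delta>" "c < ?\<alpha>" using a_less[OF \<nu>'(3) i] a_ge[OF i, of \<nu>'] \<nu>'(2) by auto
    have M_ge: "?M \<noteq> {}" "\<And>\<xi>. \<xi> \<in> ?M \<Longrightarrow> c \<le> \<xi>"
      using L_nonempty_ge[OF \<alpha>(1) c(1) \<alpha>(2)] by auto
    have "\<gamma> \<le> \<xi> \<and> \<xi> < \<delta>" if "\<xi> \<in> ?M" for \<xi>
      using order_trans[OF c(2) M_ge(2)[OF that]] that \<alpha>(1)
        lower_trace_subset[OF C_seq, of ?\<alpha> \<delta>] by auto
    then have M: "?M \<noteq> {}" "?M \<subseteq> {\<gamma>..<\<delta>}" "finite ?M"
      using M_ge(1) by (auto simp: finite_lower_trace)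
    have lt: "\<xi> < \<eta>" if "\<xi> \<in> L \<delta> ?\<beta>" "\<eta> \<in> ?M" for \<xi> \<eta>
      using low[OF m that(1)] that(2) M(2) by force
    have app: "L ?\<alpha> ?\<beta> = L \<delta> ?\<beta> \<union> ?M"
    proof (rule L_append)
      show "\<xi> < ?\<alpha>" if "\<xi> \<in> L \<delta> ?\<beta>" for \<xi>
        using low[OF m that] c(2) \<alpha>(2) by simp
    qed (use \<alpha>(1) b_gt[OF m] lt in auto)
    have same: "e ?\<alpha> \<xi> = e (a \<nu> i) \<xi>" if "\<xi> \<in> L \<delta> ?\<beta>" for \<xi>
      using acode_eqD[OF \<nu>'(1) i low[OF m that]] .
    have fin: "finite (L \<delta> ?\<beta>)" by (rule finite_lower_trace)
    have ne: "L \<delta> ?\<beta> \<noteq> {}" using \<mu>(2)[OF m] by (simp add: ends_high_def)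
    have "e ?\<beta> (Max (L \<delta> ?\<beta>)) < e ?\<alpha> (Max (L \<delta> ?\<beta>))"
      using \<mu>(2)[OF m] i same[OF Max_in[OF fin ne]] by (simp add: ends_high_def)
    moreover have "osc_on (L \<delta> ?\<beta>) (e ?\<alpha>) (e ?\<beta>) = osc_at \<nu> i (\<mu> m)"
      using same by (intro osc_on_cong fin) auto
    moreover have "osc_on ?M (e ?\<alpha>) (e ?\<beta>) = osc_on ?M (e ?\<alpha>) (e (b (\<mu> 0)))"
      using agree[OF m] M(2) by (intro osc_on_cong M(3)) force+
    ultimately show ?thesis
      using osc_on_append[OF fin ne M(3,1) lt, of "e ?\<alpha>" "e ?\<beta>"] \<alpha>(1) b_gt[OF m]
      by (simp add: osc_eq_osc_on app)
  qed
  note osc_eq = this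
  have "a \<nu>' i < b (\<mu> m) \<and> osc C (a \<nu>' i) (b (\<mu> m)) = osc C (a \<nu>' i) (b (\<mu> 0)) + m"
    if "m \<le> n" "i < k" for m i
    using osc_eq[OF that] osc_eq[OF _ that(2), of 0] \<mu>(3)[OF that] by simp
  then show ?thesis by blast
qed

end

text \<open>That the increments are the same for all entries of the tuple is what matters below: exponents that are
shifted simultaneously are the subject of Kronecker's theorem.\<close>

theorem (in families) oscillation_theorem:
  obtains \<nu> \<mu> where
    "\<And>m i. m \<le> n \<Longrightarrow> i < k \<Longrightarrow> a \<nu> i < b (\<mu> m)"
    "\<And>m i. m \<le> n \<Longrightarrow> i < k \<Longrightarrow> osc C (a \<nu> i) (b (\<mu> m)) = osc C (a \<nu> i) (b (\<mu> 0)) + m"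
proof -
  obtain \<delta> where "\<exists>\<eta>. \<eta> < \<delta>" "\<And>\<eta>. \<eta> < \<delta> \<Longrightarrow> \<exists>\<eta>'. \<eta> < \<eta>' \<and> \<eta>' < \<delta>"
    "\<And>\<gamma> S. \<gamma> < \<delta> \<Longrightarrow> S \<in> test_sets \<gamma> \<Longrightarrow>
       (\<exists>\<eta><\<delta>. \<forall>\<zeta>\<in>S. \<zeta> < \<eta>) \<or> unbounded S \<and> (\<forall>\<eta><\<delta>. \<exists>\<zeta>\<in>S. \<eta> < \<zeta> \<and> \<zeta> < \<delta>)"
    using reflection[of test_sets, OF countable_test_sets] by blast
  then interpret reflection_point C k a b \<delta> by unfold_locales
  show thesis using oscillation[of n] that by blast
qed

section \<open>Powers of rationally independent points of the circle\<close>

lemma circle_iff: "w \<in> circle \<longleftrightarrow> norm w = 1"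
proof -
  have "w * cnj w = 1 \<longleftrightarrow> complex_of_real ((norm w)\<^sup>2) = of_real 1"
    unfolding complex_norm_square by simp
  also have "\<dots> \<longleftrightarrow> (norm w)\<^sup>2 = 1" by (simp only: of_real_eq_iff)
  also have "\<dots> \<longleftrightarrow> norm w = 1" using norm_ge_zero[of w] by (auto simp: power2_eq_1_iff simp del: norm_ge_zero)
  finally show ?thesis by (simp add: circle_def)
qed

lemma cis_sum: "finite I \<Longrightarrow> cis (\<Sum>i\<in>I. x i) = (\<Prod>i\<in>I. cis (x i))"
  by (induction I rule: finite_induct) (auto simp: cis_mult[symmetric])

lemma rationally_independent_inj:
  fixes a :: "nat \<Rightarrow> 'i"
  assumes "rationally_independent z" "inj_on a {..<k}" "(\<Prod>i<k. z (a i) powi n i) = 1" "i < k"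
  shows "n i = 0"
proof -
  define n' where "n' = n \<circ> inv_into {..<k} a"
  have n': "n' (a j) = n j" if "j < k" for j
    using that assms(2) by (simp add: n'_def inv_into_f_f)
  have "(\<Prod>\<alpha>\<in>a ` {..<k}. z \<alpha> powi n' \<alpha>) = (\<Prod>i<k. z (a i) powi n i)"
    by (simp add: prod.reindex[OF assms(2)] n')
  then have "n' (a i) = 0"
    using assms(1)[unfolded rationally_independent_def, rule_format, of "a ` {..<k}" n' "a i"]
      assms(3,4) by simp
  then show ?thesis using n'[OF assms(4)] by simp
qed

text \<open>Kronecker's approximation theorem in multiplicative form: together with \<open>1\<close>, the normalised arguments of
the \<open>z\<^sub>\<alpha>\<close> are linearly independent over the integers.\<close>

lemma kronecker_circle:
  fixes a :: "nat \<Rightarrow> 'i"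
  assumes z: "\<And>\<alpha>. z \<alpha> \<in> circle" and ind: "rationally_independent z" and inj: "inj_on a {..<k}"
    and v: "\<And>i. i < k \<Longrightarrow> v i \<in> circle" and "0 < \<epsilon>"
  obtains n :: int where "\<And>i. i < k \<Longrightarrow> dist (z (a i) powi n) (v i) < \<epsilon>"
proof -
  interpret Modules.module "(\<lambda>r. (*) (real_of_int r))"
    by (simp add: Modules.module.intro distrib_left mult.commute)
  define \<theta> where "\<theta> i = (if i < k then Arg (z (a i)) / (2 * pi) else 1)" for i
  define \<alpha> where "\<alpha> i = Arg (v i) / (2 * pi)" for i
  have cis_Arg1: "cis (Arg w) = w" if "w \<in> circle" for w
    using that cis_Arg[of w] by (cases "w = 0") (auto simp: circle_iff sgn_div_norm)
  have z_cis: "z (a i) = cis (2 * pi * \<theta> i)" if "i < k" for i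
    using that cis_Arg1[OF z] by (simp add: \<theta>_def)
  have v_cis: "v i = cis (2 * pi * \<alpha> i)" if "i < k" for i
    using cis_Arg1[OF v[OF that]] by (simp add: \<alpha>_def)
  have rel: "\<forall>i\<le>k. n i = 0" if sum0: "(\<Sum>i\<le>k. of_int (n i) * \<theta> i) = 0" for n :: "nat \<Rightarrow> int"
  proof -
    have s: "(\<Sum>i<k. of_int (n i) * \<theta> i) = - of_int (n k)"
      using sum0 by (simp add: lessThan_Suc_atMost[symmetric] \<theta>_def)
    have "(\<Prod>i<k. z (a i) powi n i) = (\<Prod>i<k. cis (2 * pi * (of_int (n i) * \<theta> i)))"
      by (intro prod.cong) (simp_all add: z_cis cis_power_int algebra_simps)
    also have "\<dots> = cis (2 * pi * (\<Sum>i<k. of_int (n i) * \<theta> i))"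
      by (simp add: cis_sum[symmetric] sum_distrib_left)
    also have "\<dots> = 1" unfolding s by (rule cis_multiple_2pi) simp
    finally have n0: "n i = 0" if "i < k" for i
      using rationally_independent_inj[OF ind inj _ that] by blast
    then have "of_int (n k) = (0::real)" using s by simp
    then show ?thesis using n0 by (auto simp: le_less)
  qed
  have inj\<theta>: "inj_on \<theta> {..k}"
  proof (rule inj_onI, rule ccontr)
    fix i j assume ij: "i \<in> {..k}" "j \<in> {..k}" "\<theta> i = \<theta> j" "i \<noteq> j"
    let ?n = "\<lambda>l. if l = i then 1 else if l = j then - 1 else (0 :: int)"
    have "(\<Sum>l\<le>k. of_int (?n l) * \<theta> l) = (\<Sum>l\<in>{i, j}. of_int (?n l) * \<theta> l)"
      using ij by (intro sum.mono_neutral_right) auto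
    also have "\<dots> = 0" using ij by simp
    finally show False using rel[of ?n] ij(1) by auto
  qed
  have indep: "independent (\<theta> ` {..k})"
  proof -
    have "u x = 0" if "(\<Sum>x\<in>\<theta> ` {..k}. of_int (u x) * x) = 0" "x \<in> \<theta> ` {..k}" for u :: "real \<Rightarrow> int" and x
      using rel[of "u \<circ> \<theta>"] that by (auto simp: sum.reindex[OF inj\<theta>])
    then show ?thesis by (subst dependent_finite) auto
  qed
  obtain d where d: "0 < d" "\<And>x. \<bar>x\<bar> < d \<Longrightarrow> dist (cis x) 1 < \<epsilon>"
  proof -
    have "(cis \<longlongrightarrow> cis 0) (at 0)" by (intro tendsto_cis tendsto_ident_at)
    then have "\<forall>\<^sub>F x in at 0. dist (cis x) 1 < \<epsilon>"
      using tendstoD[OF _ \<open>0 < \<epsilon>\<close>] by fastforce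
    then obtain d where "0 < d" "\<And>x. x \<noteq> 0 \<Longrightarrow> dist x 0 < d \<Longrightarrow> dist (cis x) 1 < \<epsilon>"
      unfolding eventually_at by blast
    then show thesis using that[of d] \<open>0 < \<epsilon>\<close> by (metis cis_zero diff_0_right dist_self dist_norm real_norm_def)
  qed
  obtain n m where nm: "\<And>i. i < k \<Longrightarrow> \<bar>of_int n * \<theta> i - of_int (m i) - \<alpha> i\<bar> < d / (2 * pi)"
    using Kronecker_thm_2[OF indep inj\<theta>, of "d / (2 * pi)" \<alpha>] d(1) by (auto simp: \<theta>_def)
  have scale: "\<bar>2 * pi * x\<bar> < d" if "\<bar>x\<bar> < d / (2 * pi)" for x
    using that by (simp add: abs_mult field_simps)
  show thesis
  proof
    fix i assume i: "i < k"
    let ?x = "of_int n * \<theta> i - of_int (m i) - \<alpha> i"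
    have "z (a i) powi n = cis (2 * pi * (of_int n * \<theta> i))"
      by (simp add: z_cis[OF i] cis_power_int algebra_simps)
    also have "2 * pi * (of_int n * \<theta> i) = 2 * pi * ?x + (2 * pi * of_int (m i) + 2 * pi * \<alpha> i)"
      by (simp add: algebra_simps)
    also have "cis \<dots> = cis (2 * pi * ?x) * v i"
      by (simp add: cis_mult[symmetric] v_cis[OF i])
    finally have "dist (z (a i) powi n) (v i) = norm ((cis (2 * pi * ?x) - 1) * v i)"
      by (simp add: dist_norm algebra_simps)
    also have "\<dots> = dist (cis (2 * pi * ?x)) 1"
      using v[OF i] by (simp add: norm_mult circle_iff dist_norm)
    also have "\<dots> < \<epsilon>"
      using nm[OF i] scale by (intro d(2)) blast
    finally show "dist (z (a i) powi n) (v i) < \<epsilon>" .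
  qed
qed

text \<open>The cell of a square grid of mesh \<open>\<epsilon>/2\<close>: points of equal colour are \<open>\<epsilon>\<close>-close, and for a countable or finite set
of colours the pigeonhole principle applies.\<close>

definition colour :: "real \<Rightarrow> complex \<Rightarrow> int \<times> int" where
  "colour \<epsilon> w = (\<lfloor>Re w * 2 / \<epsilon>\<rfloor>, \<lfloor>Im w * 2 / \<epsilon>\<rfloor>)"

lemma colour_dist:
  assumes "0 < \<epsilon>" "colour \<epsilon> v = colour \<epsilon> w"
  shows "dist v w < \<epsilon>"
proof -
  have close: "\<bar>x - y\<bar> < \<epsilon> / 2" if "\<lfloor>x * 2 / \<epsilon>\<rfloor> = \<lfloor>y * 2 / \<epsilon>\<rfloor>" for x y :: real
  proof -
    have "\<bar>x * 2 / \<epsilon> - y * 2 / \<epsilon>\<bar> < 1" using that by linarith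
    moreover have "x * 2 / \<epsilon> - y * 2 / \<epsilon> = (x - y) * 2 / \<epsilon>" by (simp add: diff_divide_distrib left_diff_distrib)
    ultimately have "\<bar>x * 2 - y * 2\<bar> < \<epsilon>" using assms(1) by (simp add: field_simps)
    then show ?thesis by linarith
  qed
  have "dist v w \<le> \<bar>Re (v - w)\<bar> + \<bar>Im (v - w)\<bar>" unfolding dist_norm by (rule cmod_le)
  also have "\<dots> < \<epsilon>"
    using close[of "Re v" "Re w"] close[of "Im v" "Im w"] assms(2) by (simp add: colour_def)
  finally show ?thesis .
qed

lemma finite_colour_circle: "0 < \<epsilon> \<Longrightarrow> finite (colour \<epsilon> ` circle)"
proof (rule finite_subset)
  assume \<epsilon>: "0 < \<epsilon>"
  let ?B = "{\<lfloor>- 2 / \<epsilon>\<rfloor>..\<lfloor>2 / \<epsilon>\<rfloor>}"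
  have B: "\<lfloor>x * 2 / \<epsilon>\<rfloor> \<in> ?B" if "\<bar>x\<bar> \<le> 1" for x :: real
  proof -
    have "- 2 / \<epsilon> \<le> x * 2 / \<epsilon>" "x * 2 / \<epsilon> \<le> 2 / \<epsilon>" using that \<epsilon> by (auto simp: divide_simps)
    then show ?thesis unfolding atLeastAtMost_iff by (intro conjI floor_mono)
  qed
  show "colour \<epsilon> ` circle \<subseteq> ?B \<times> ?B"
  proof (rule image_subsetI)
    fix w assume "w \<in> circle"
    then have "\<bar>Re w\<bar> \<le> 1" "\<bar>Im w\<bar> \<le> 1"
      using abs_Re_le_cmod[of w] abs_Im_le_cmod[of w] by (simp_all add: circle_iff)
    then show "colour \<epsilon> w \<in> ?B \<times> ?B" unfolding colour_def by (intro SigmaI B)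
  qed
qed simp

text \<open>Only finitely many colour patterns of targets occur, so integers of bounded modulus suffice for
one representative of each.  Shifting the target by the bound \<open>M\<close> makes the exponents nonnegative.\<close>

lemma kronecker_uniform:
  fixes a :: "nat \<Rightarrow> 'i"
  assumes z: "\<And>\<alpha>. z \<alpha> \<in> circle" and ind: "rationally_independent z" and inj: "inj_on a {..<k}"
    and \<epsilon>: "0 < \<epsilon>"
  obtains N :: nat where
    "\<And>v. (\<And>i. i < k \<Longrightarrow> v i \<in> circle) \<Longrightarrow> \<exists>m\<le>N. \<forall>i<k. dist (z (a i) ^ m) (v i) < \<epsilon>"
proof -
  define c where "c v = (\<lambda>i\<in>{..<k}. colour (\<epsilon>/2) (v i))" for v
  let ?V = "{v. \<forall>i<k. v i \<in> circle}"
  have "c ` ?V \<subseteq> {..<k} \<rightarrow>\<^sub>E (colour (\<epsilon>/2) ` circle)" by (auto simp: c_def split: if_splits)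
  moreover have "finite ({..<k} \<rightarrow>\<^sub>E (colour (\<epsilon>/2) ` circle))"
    using finite_colour_circle[of "\<epsilon>/2"] \<epsilon> by (intro finite_PiE) auto
  ultimately have "finite (c ` ?V)" by (rule finite_subset)
  then obtain R where R: "R \<subseteq> ?V" "finite R" "c ` ?V = c ` R"
    by (meson finite_subset_image subset_refl)
  have "\<exists>n::int. \<forall>i<k. dist (z (a i) powi n) (v i) < \<epsilon>/2" if "v \<in> R" for v
    using kronecker_circle[OF z ind inj, of v "\<epsilon>/2"] that R(1) \<epsilon> by (metis (mono_tags, lifting) half_gt_zero mem_Collect_eq subsetD)
  then obtain n :: "(nat \<Rightarrow> complex) \<Rightarrow> int"
    where n: "\<And>v i. v \<in> R \<Longrightarrow> i < k \<Longrightarrow> dist (z (a i) powi n v) (v i) < \<epsilon>/2" by metis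
  define M where "M = (\<Sum>v\<in>R. \<bar>n v\<bar>)"
  have nM: "\<bar>n v\<bar> \<le> M" if "v \<in> R" for v
    unfolding M_def using that R(2) by (intro member_le_sum) auto
  show thesis
  proof
    fix v :: "nat \<Rightarrow> complex" assume v: "\<And>i. i < k \<Longrightarrow> v i \<in> circle"
    let ?v = "\<lambda>i. v i * z (a i) powi (- M)"
    have z0: "z \<alpha> \<noteq> 0" for \<alpha> using z[of \<alpha>] by (auto simp: circle_iff)
    have nz: "norm (z \<alpha> powi l) = 1" for \<alpha> l using z[of \<alpha>] by (simp add: circle_iff norm_power_int)
    have "?v \<in> ?V" using v nz by (auto simp: circle_iff norm_mult)
    then have "c ?v \<in> c ` R" unfolding R(3)[symmetric] by (rule imageI)
    then obtain r where r: "r \<in> R" "c ?v = c r" by (rule imageE)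
    have nonneg: "0 \<le> n r + M" "n r + M \<le> 2 * M" using nM[OF r(1)] by auto
    have "dist (z (a i) ^ nat (n r + M)) (v i) < \<epsilon>" if i: "i < k" for i
    proof -
      have "colour (\<epsilon>/2) (?v i) = colour (\<epsilon>/2) (r i)" using fun_cong[OF r(2), of i] i by (simp add: c_def)
      then have "dist (?v i) (r i) < \<epsilon>/2" using colour_dist[of "\<epsilon>/2"] \<epsilon> by simp
      then have *: "dist (z (a i) powi n r) (?v i) < \<epsilon>"
        using n[OF r(1) i] dist_triangle_half_l[of "z (a i) powi n r" "r i" \<epsilon> "?v i"] by simp
      have "z (a i) ^ nat (n r + M) = z (a i) powi n r * z (a i) powi M"
        using nonneg z0 by (simp add: power_int_def[of _ "n r + M"] flip: power_int_add)
      moreover have "v i = ?v i * z (a i) powi M"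
        using z0 by (simp add: power_int_minus power_int_not_zero)
      ultimately have "dist (z (a i) ^ nat (n r + M)) (v i) = norm ((z (a i) powi n r - ?v i) * z (a i) powi M)"
        unfolding dist_norm by (metis left_diff_distrib)
      also have "\<dots> = dist (z (a i) powi n r) (?v i)" by (simp only: norm_mult nz mult_1_right dist_norm)
      finally show ?thesis using * by simp
    qed
    then show "\<exists>m\<le>nat (2 * M). \<forall>i<k. dist (z (a i) ^ m) (v i) < \<epsilon>"
      using nonneg by (intro exI[of _ "nat (n r + M)"]) simp
  qed
qed

section \<open>Closures of unbounded subsets of Moore's space\<close>

text \<open>The number of exponents to be tried depends on the tuple, but it is the same \<open>n\<close> for unboundedly many tuples, to
which the oscillation theorem applies.  One of the shifts \<open>m \<le> n\<close> then moves the exponents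
\<open>osc(\<alpha>\<^sub>i, b (\<mu> 0)) + 1\<close> to exponents that work.\<close>

lemma o_fun_dense:
  assumes fam: "families C k a b" and inj: "\<And>\<nu>. inj_on (a \<nu>) {..<k}"
    and z: "\<And>\<alpha>. z \<alpha> \<in> circle" and ind: "rationally_independent z"
    and u: "\<And>i. i < k \<Longrightarrow> u i \<in> circle" and \<epsilon>: "0 < \<epsilon>"
  obtains \<nu> \<mu> where "\<And>i. i < k \<Longrightarrow> a \<nu> i < b \<mu>"
    "\<And>i. i < k \<Longrightarrow> dist (o_fun C z (a \<nu> i) (b \<mu>)) (u i) < \<epsilon>"
proof -
  let ?P = "\<lambda>\<nu> N. \<forall>v. (\<forall>i<k. v i \<in> circle) \<longrightarrow> (\<exists>m\<le>N. \<forall>i<k. dist (z (a \<nu> i) ^ m) (v i) < \<epsilon>)"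
  have "\<exists>N::nat. ?P \<nu> N" for \<nu>
    by (rule kronecker_uniform[OF z ind inj[of \<nu>] \<epsilon>]) blast
  then obtain N where N: "\<And>\<nu>. ?P \<nu> (N \<nu>)" by metis
  obtain n where n: "unbounded {\<nu> \<in> UNIV. N \<nu> = n}"
    by (rule unbounded_pigeonhole[OF unbounded_UNIV])
  have "\<exists>\<nu>'. \<nu> < \<nu>' \<and> N \<nu>' = n" for \<nu>
    by (rule unboundedE[OF n, of \<nu>]) blast
  then obtain f where f: "\<And>\<nu>. \<nu> < f \<nu>" "\<And>\<nu>. N (f \<nu>) = n" by metis
  interpret families C k a b by (rule fam)
  interpret thin: families C k "\<lambda>\<nu>. a (f \<nu>)" b
    using a_ge b_ge less_imp_le[OF f(1)] order_trans by unfold_locales blast+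
  obtain \<nu> \<mu> where less: "\<And>m i. m \<le> n \<Longrightarrow> i < k \<Longrightarrow> a (f \<nu>) i < b (\<mu> m)"
    and osc: "\<And>m i. m \<le> n \<Longrightarrow> i < k \<Longrightarrow> osc C (a (f \<nu>) i) (b (\<mu> m)) = osc C (a (f \<nu>) i) (b (\<mu> 0)) + m"
    using thin.oscillation_theorem[of n] by blast
  let ?\<alpha> = "a (f \<nu>)"
  let ?s = "\<lambda>i. osc C (?\<alpha> i) (b (\<mu> 0)) + 1"
  have norm_z: "norm (z \<alpha> ^ j) = 1" for \<alpha> j using z[of \<alpha>] by (simp add: circle_iff norm_power)
  have "\<forall>i<k. u i / z (?\<alpha> i) ^ ?s i \<in> circle"
    using u norm_z by (simp only: circle_iff norm_divide) simp
  then have "\<exists>m\<le>n. \<forall>i<k. dist (z (?\<alpha> i) ^ m) (u i / z (?\<alpha> i) ^ ?s i) < \<epsilon>"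
    unfolding f(2)[of \<nu>, symmetric] by (rule N[THEN spec, THEN mp])
  then obtain m where m: "m \<le> n" "\<And>i. i < k \<Longrightarrow> dist (z (?\<alpha> i) ^ m) (u i / z (?\<alpha> i) ^ ?s i) < \<epsilon>"
    by blast
  show thesis
  proof
    fix i assume i: "i < k"
    show "?\<alpha> i < b (\<mu> m)" by (rule less[OF m(1) i])
    have nz: "z (?\<alpha> i) ^ ?s i \<noteq> 0" using norm_z[of "?\<alpha> i" "?s i"] by auto
    have "o_fun C z (?\<alpha> i) (b (\<mu> m)) = z (?\<alpha> i) ^ m * z (?\<alpha> i) ^ ?s i"
      by (simp add: o_fun_def osc[OF m(1) i] power_add)
    then have "o_fun C z (?\<alpha> i) (b (\<mu> m)) - u i = (z (?\<alpha> i) ^ m - u i / z (?\<alpha> i) ^ ?s i) * z (?\<alpha> i) ^ ?s i"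
      using nz by (simp add: left_diff_distrib)
    then show "dist (o_fun C z (?\<alpha> i) (b (\<mu> m))) (u i) < \<epsilon>"
      using m(2)[OF i] by (simp only: dist_norm norm_mult norm_z mult_1_right)
  qed
qed

context walks
begin

lemma C_osuc: "C (osuc \<beta>) = {\<beta>}"
  using C_seq by (auto simp: C_sequence_def)

lemma step_osuc: "\<alpha> \<le> \<beta> \<Longrightarrow> step \<alpha> (osuc \<beta>) = \<beta>"
  using step_in[of \<alpha> "osuc \<beta>"] by (simp add: C_osuc less_osuc_iff)

lemma e_osuc: "\<alpha> < \<beta> \<Longrightarrow> e (osuc \<beta>) \<alpha> = e \<beta> \<alpha>"
  using e_rec[of \<alpha> "osuc \<beta>"] by (simp add: step_osuc less_osuc_iff C_osuc)

lemma L_osuc: "\<alpha> < \<beta> \<Longrightarrow> L \<alpha> (osuc \<beta>) = L \<alpha> \<beta>"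
  using lower_trace_rec[OF C_seq, of \<alpha> "osuc \<beta>"] by (simp add: step_osuc less_osuc_iff C_osuc)

text \<open>The walk from \<open>\<beta> + 1\<close> passes through \<open>\<beta>\<close>, and the additional step leaves no mark on the lower trace
and on the functions \<open>e\<close>.\<close>

lemma w_fun_osuc:
  assumes "\<alpha> < \<beta>"
  shows "w_fun C z (osuc \<beta>) \<alpha> = w_fun C z \<beta> \<alpha>"
proof -
  have "osc C \<alpha> (osuc \<beta>) = osc C \<alpha> \<beta>"
    unfolding osc_eq_osc_on L_osuc[OF assms]
    using lower_trace_subset[OF C_seq, of \<alpha> \<beta>] assms
    by (intro osc_on_cong finite_lower_trace) (auto intro!: e_osuc)
  then show ?thesis using assms by (simp add: w_fun_def o_fun_def less_osuc_iff)
qed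

lemma w_fun_osuc_funpow: "\<alpha> < \<beta> \<Longrightarrow> w_fun C z ((osuc ^^ j) \<beta>) \<alpha> = w_fun C z \<beta> \<alpha> \<and> \<alpha> < (osuc ^^ j) \<beta>"
  by (induction j) (auto simp: w_fun_osuc less_osuc_iff)

text \<open>Reflection replaces a \<open>\<Delta>\<close>-system argument.  Some \<open>\<beta>0 \<in> E\<close> lies above the reflecting ordinal \<open>\<delta>\<close>; with
\<open>r = A \<beta>0 \<inter> \<delta>\<close>, there are unboundedly many \<open>\<zeta>\<close> for which some \<open>\<beta> \<ge> \<zeta>\<close> in \<open>E\<close> satisfies \<open>A \<beta> \<inter> \<zeta> = r\<close> and assigns
the same colours as \<open>\<beta>0\<close>.  On \<open>r\<close> the functions \<open>h \<beta>\<close> are functions \<open>w\<^sub>\<beta>\<close> of the same colours; the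
remaining parts of the \<open>A \<beta>\<close> are tuples to which \<open>o_fun_dense\<close> applies.\<close>

lemma w_fun_approximates:
  fixes h :: "omega1 \<Rightarrow> omega1 \<Rightarrow> complex" and A :: "omega1 \<Rightarrow> omega1 set"
  assumes z: "\<And>\<alpha>. z \<alpha> \<in> circle" and ind: "rationally_independent z"
    and E: "unbounded E" and A: "\<And>\<beta>. finite (A \<beta>)" and \<epsilon>: "0 < \<epsilon>"
    and h_w: "\<And>\<beta> \<xi>. \<xi> < \<beta> \<Longrightarrow> h \<beta> \<xi> = w_fun C z \<beta> \<xi>" and h: "\<And>\<beta> \<xi>. h \<beta> \<xi> \<in> circle"
  obtains \<beta> \<beta>' where "\<beta> \<in> E" "\<beta>' \<in> E" "\<And>\<xi>. \<xi> \<in> A \<beta> \<Longrightarrow> dist (w_fun C z \<beta>' \<xi>) (h \<beta> \<xi>) < \<epsilon>"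
proof -
  let ?c = "colour (\<epsilon>/2)"
  \<comment> \<open>The colours are listed separately on \<open>r\<close>, where they are compared at equal coordinates, and on the rest, where they are compared at equal positions.\<close>
  define S where "S r l1 l2 = {\<zeta>. \<exists>\<beta>\<in>E. \<zeta> \<le> \<beta> \<and> A \<beta> \<inter> {..<\<zeta>} = r \<and>
     map (?c \<circ> h \<beta>) (sorted_list_of_set r) = l1 \<and>
     map (?c \<circ> h \<beta>) (sorted_list_of_set (A \<beta> - r)) = l2}" for r l1 l2
  define F where "F \<gamma> = (\<lambda>(r, l1, l2). S r l1 l2) ` ({r. finite r \<and> r \<subseteq> {..<\<gamma>}} \<times> UNIV)" for \<gamma>
  have cF: "countable (F \<gamma>)" for \<gamma>
    unfolding F_def
    by (intro countable_image countable_SIGMA countable_Collect_finite_subset countable_lessThan_omega1) simp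
  obtain \<delta> where \<delta>: "\<exists>\<eta>. \<eta> < \<delta>" "\<And>\<eta>. \<eta> < \<delta> \<Longrightarrow> \<exists>\<eta>'. \<eta> < \<eta>' \<and> \<eta>' < \<delta>"
    "\<And>\<gamma> S. \<gamma> < \<delta> \<Longrightarrow> S \<in> F \<gamma> \<Longrightarrow>
       (\<exists>\<eta><\<delta>. \<forall>\<zeta>\<in>S. \<zeta> < \<eta>) \<or> unbounded S \<and> (\<forall>\<eta><\<delta>. \<exists>\<zeta>\<in>S. \<eta> < \<zeta> \<and> \<zeta> < \<delta>)"
    using reflection[of F, OF cF] by blast
  obtain \<beta>0 where \<beta>0: "\<beta>0 \<in> E" "\<delta> < \<beta>0" using E by (rule unboundedE)
  define r where "r = A \<beta>0 \<inter> {..<\<delta>}"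
  define l1 where "l1 = map (?c \<circ> h \<beta>0) (sorted_list_of_set r)"
  define l2 where "l2 = map (?c \<circ> h \<beta>0) (sorted_list_of_set (A \<beta>0 - r))"
  have fr: "finite r" using A by (simp add: r_def)
  obtain \<gamma> where \<gamma>: "\<gamma> < \<delta>" "r \<subseteq> {..<\<gamma>}"
    using limit_finite_bounded[OF \<delta>(1,2) fr] by (auto simp: r_def)
  have "S r l1 l2 \<in> F \<gamma>" using fr \<gamma>(2) unfolding F_def by (intro rev_image_eqI[of "(r, l1, l2)"]) auto
  moreover have "\<delta> \<in> S r l1 l2"
    using \<beta>0 unfolding S_def mem_Collect_eq
    by (intro bexI[of _ \<beta>0]) (auto simp: r_def l1_def l2_def)
  ultimately have unb: "unbounded (S r l1 l2)"
    using \<delta>(3)[OF \<gamma>(1)] less_asym by blast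
  have "\<exists>\<beta> \<zeta>. \<beta> \<in> E \<and> \<nu> < \<zeta> \<and> \<zeta> \<le> \<beta> \<and> A \<beta> \<inter> {..<\<zeta>} = r \<and>
     map (?c \<circ> h \<beta>) (sorted_list_of_set r) = l1 \<and>
     map (?c \<circ> h \<beta>) (sorted_list_of_set (A \<beta> - r)) = l2" for \<nu>
    by (rule unboundedE[OF unb, of \<nu>]) (unfold S_def, blast)
  then obtain b \<zeta> where b: "\<And>\<nu>. b \<nu> \<in> E" "\<And>\<nu>. \<nu> < \<zeta> \<nu>" "\<And>\<nu>. \<zeta> \<nu> \<le> b \<nu>" "\<And>\<nu>. A (b \<nu>) \<inter> {..<\<zeta> \<nu>} = r"
    "\<And>\<nu>. map (?c \<circ> h (b \<nu>)) (sorted_list_of_set r) = l1"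
    "\<And>\<nu>. map (?c \<circ> h (b \<nu>)) (sorted_list_of_set (A (b \<nu>) - r)) = l2"
    by metis
  define k where "k = length l2"
  define l where "l \<nu> = sorted_list_of_set (A (b \<nu>) - r)" for \<nu>
  define a where "a \<nu> i = l \<nu> ! i" for \<nu> i
  have set_l: "set (l \<nu>) = A (b \<nu>) - r" and distinct_l: "distinct (l \<nu>)" for \<nu>
    using A[of "b \<nu>"] by (simp_all add: l_def)
  have l_colours: "map (?c \<circ> h (b \<nu>)) (l \<nu>) = l2" for \<nu> unfolding l_def by (rule b(6))
  have len: "length (l \<nu>) = k" for \<nu>
    unfolding k_def l_colours[of \<nu>, symmetric] by (rule length_map[symmetric])
  have a_in: "a \<nu> i \<in> A (b \<nu>) - r" if "i < k" for \<nu> i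
    unfolding a_def set_l[symmetric] using that len[of \<nu>] by (intro nth_mem) simp
  have a_surj: "\<exists>i<k. \<xi> = a \<nu> i" if "\<xi> \<in> A (b \<nu>) - r" for \<nu> \<xi>
    using that unfolding a_def set_l[symmetric] in_set_conv_nth len by blast
  have a_colour: "?c (h (b \<nu>) (a \<nu> i)) = l2 ! i" if "i < k" for \<nu> i
    using that by (simp add: l_colours[of \<nu>, symmetric] a_def len)
  have fam: "families C k a b"
  proof
    show "\<nu> \<le> a \<nu> i" if "i < k" for \<nu> i
    proof -
      have "\<not> a \<nu> i < \<zeta> \<nu>" using a_in[OF that, of \<nu>] b(4)[of \<nu>] by blast
      then show ?thesis using b(2)[of \<nu>] by simp
    qed
    show "\<nu> \<le> b \<nu>" for \<nu> using b(2,3)[of \<nu>] by simp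
  qed
  have inj: "inj_on (a \<nu>) {..<k}" for \<nu>
    by (auto simp: inj_on_def a_def nth_eq_iff_index_eq[OF distinct_l] len)
  have "0 < \<epsilon> / 2" using \<epsilon> by simp
  then obtain \<nu> \<mu> where less: "\<And>i. i < k \<Longrightarrow> a \<nu> i < b \<mu>"
    and near: "\<And>i. i < k \<Longrightarrow> dist (o_fun C z (a \<nu> i) (b \<mu>)) (h (b 0) (a 0 i)) < \<epsilon>/2"
    using o_fun_dense[OF fam inj z ind, of "\<lambda>i. h (b 0) (a 0 i)" "\<epsilon>/2"] h by blast
  show thesis
  proof (rule that[of "b \<nu>" "b \<mu>"])
    fix \<xi> assume \<xi>: "\<xi> \<in> A (b \<nu>)"
    show "dist (w_fun C z (b \<mu>) \<xi>) (h (b \<nu>) \<xi>) < \<epsilon>"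
    proof (cases "\<xi> \<in> r")
      case True
      have "map (?c \<circ> h (b \<nu>)) (sorted_list_of_set r) = map (?c \<circ> h (b \<mu>)) (sorted_list_of_set r)"
        by (simp only: b(5))
      then have "?c (h (b \<nu>) \<xi>) = ?c (h (b \<mu>) \<xi>)"
        unfolding map_eq_conv using fr True by simp
      then have "dist (h (b \<mu>) \<xi>) (h (b \<nu>) \<xi>) < \<epsilon>/2"
        using colour_dist[of "\<epsilon>/2"] \<epsilon> by simp
      moreover have "\<xi> < b \<mu>"
        using True b(4)[of \<mu>] b(3)[of \<mu>] by force
      ultimately show ?thesis using h_w[of \<xi> "b \<mu>"] \<epsilon> by simp
    next
      case False
      then obtain i where i: "i < k" "\<xi> = a \<nu> i" using a_surj \<xi> by blast
      have "dist (h (b \<nu>) (a \<nu> i)) (h (b 0) (a 0 i)) < \<epsilon>/2"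
        using colour_dist[of "\<epsilon>/2"] \<epsilon> a_colour[OF i(1)] by simp
      then have "dist (o_fun C z (a \<nu> i) (b \<mu>)) (h (b \<nu>) (a \<nu> i)) < \<epsilon>"
        using near[OF i(1)] dist_triangle_half_l by blast
      then show ?thesis using less[OF i(1)] i(2) by (simp add: w_fun_def)
    qed
  qed (rule b(1))+
qed

end

section \<open>Moore's space is not a Delta-space\<close>

lemma w_fun_circle:
  assumes "\<And>\<alpha>. z \<alpha> \<in> circle"
  shows "w_fun C z \<beta> \<alpha> \<in> circle"
  using assms[of \<alpha>] by (simp add: w_fun_def o_fun_def circle_iff norm_mult norm_power)

text \<open>For \<open>\<alpha> < \<beta>\<close> the functions differ at \<open>\<alpha>\<close>: a positive power of \<open>z\<^sub>\<alpha>\<close> is not \<open>1\<close>, and this is the reason for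
adding \<open>1\<close> to the oscillation number.\<close>

lemma w_fun_inj:
  assumes "rationally_independent z"
  shows "inj (w_fun C z)"
proof (rule linorder_injI)
  fix \<alpha> \<beta> :: omega1 assume less: "\<alpha> < \<beta>"
  let ?n = "osc C \<alpha> \<beta> + 1"
  have "w_fun C z \<beta> \<alpha> \<noteq> 1"
  proof
    assume "w_fun C z \<beta> \<alpha> = 1"
    then have "(\<Prod>\<xi>\<in>{\<alpha>}. z \<xi> powi int ?n) = 1"
      using less by (simp add: w_fun_def o_fun_def power_int_of_nat del: of_nat_add of_nat_Suc)
    then have "int ?n = 0"
      using assms[unfolded rationally_independent_def, rule_format, of "{\<alpha>}" "\<lambda>_. int ?n" \<alpha>] by blast
    then show False by simp
  qed
  moreover have "w_fun C z \<alpha> \<alpha> = 1" by (simp add: w_fun_def)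
  ultimately show "w_fun C z \<alpha> \<noteq> w_fun C z \<beta>" by metis
qed

lemma moore_space_basic_neighbourhood:
  assumes "openin (moore_space C z) U" "w \<in> U" and z: "\<And>\<alpha>. z \<alpha> \<in> circle"
  obtains A \<epsilon> where "finite A" "0 < \<epsilon>"
    "\<And>\<beta>. (\<And>\<xi>. \<xi> \<in> A \<Longrightarrow> dist (w_fun C z \<beta> \<xi>) (w \<xi>) < \<epsilon>) \<Longrightarrow>
       w_fun C z \<beta> \<in> U"
proof -
  obtain T where T: "openin (product_topology (\<lambda>_. top_of_set circle) UNIV) T" "U = T \<inter> range (w_fun C z)"
    using assms(1) by (auto simp: moore_space_def openin_subtopology)
  with assms(2) obtain V where V: "finite {\<xi>. V \<xi> \<noteq> circle}" "\<And>\<xi>. openin (top_of_set circle) (V \<xi>)"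
    "w \<in> Pi\<^sub>E UNIV V" "Pi\<^sub>E UNIV V \<subseteq> T"
    by (auto simp: openin_product_topology_alt)
  let ?A = "{\<xi>. V \<xi> \<noteq> circle}"
  have wV: "w \<xi> \<in> V \<xi>" for \<xi> using V(3) by (auto simp: PiE_def)
  have "\<exists>e>0. \<forall>x\<in>circle. dist x (w \<xi>) < e \<longrightarrow> x \<in> V \<xi>" for \<xi>
    using V(2)[of \<xi>] wV[of \<xi>] unfolding openin_euclidean_subtopology_iff by blast
  then obtain r where r: "\<And>\<xi>. 0 < r \<xi>" "\<And>\<xi> x. x \<in> circle \<Longrightarrow> dist x (w \<xi>) < r \<xi> \<Longrightarrow> x \<in> V \<xi>"
    by metis
  let ?\<epsilon> = "Min (insert 1 (r ` ?A))"
  show thesis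
  proof
    show "finite ?A" by (rule V(1))
    show "0 < ?\<epsilon>" using V(1) r(1) by (subst Min_gr_iff) auto
    fix \<beta> assume near: "\<And>\<xi>. \<xi> \<in> ?A \<Longrightarrow> dist (w_fun C z \<beta> \<xi>) (w \<xi>) < ?\<epsilon>"
    note c = w_fun_circle[of z, OF z]
    have "w_fun C z \<beta> \<xi> \<in> V \<xi>" for \<xi>
    proof (cases "\<xi> \<in> ?A")
      case True
      then have "?\<epsilon> \<le> r \<xi>" using V(1) by (intro Min_le) auto
      then show ?thesis using near[OF True] by (intro r(2) c) simp
    qed (use c in auto)
    then have "w_fun C z \<beta> \<in> Pi\<^sub>E UNIV V" by auto
    then show "w_fun C z \<beta> \<in> U" using V(4) T(2) by auto
  qed
qed

theorem theorem5:
  fixes C :: "omega1 \<Rightarrow> omega1 set" and z :: "omega1 \<Rightarrow> complex"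
  assumes "C_sequence C"
    and "\<And>\<alpha>. z \<alpha> \<in> circle"
    and "rationally_independent z"
    and "special (tree_of C z) map_le"
  shows "\<not> Delta_space (moore_space C z)"
proof
  assume Delta: "Delta_space (moore_space C z)"
  interpret walks C by unfold_locales (rule assms(1))
  let ?w = "w_fun C z"
  note circ = w_fun_circle[of z C, OF assms(2)]
  obtain A :: "nat \<Rightarrow> (omega1 \<rightharpoonup> complex) set" where A_cover: "tree_of C z = (\<Union>n. A n)"
    and A_antichain: "\<forall>n. \<forall>s\<in>A n. \<forall>t\<in>A n. s \<noteq> t \<longrightarrow> \<not> s \<subseteq>\<^sub>m t \<and> \<not> t \<subseteq>\<^sub>m s"
    using assms(4) unfolding special_def by (elim exE conjE)
  define node where "node \<gamma> = (Some \<circ> ?w \<gamma>) |` {..<\<gamma>}" for \<gamma>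
  have "node \<gamma> \<in> tree_of C z" for \<gamma> unfolding tree_of_def node_def by blast
  then have "\<exists>n. node \<gamma> \<in> A n" for \<gamma> using A_cover by blast
  then obtain idx where idx: "\<And>\<gamma>. node \<gamma> \<in> A (idx \<gamma>)" by metis
  have osuc_mono: "(osuc ^^ i) \<beta> < (osuc ^^ j) \<beta>" if "i < j" for i j \<beta>
    by (rule lift_Suc_mono_less[OF _ that]) (simp add: less_osuc)
  have idx_neq: "idx ((osuc ^^ i) \<beta>) \<noteq> idx ((osuc ^^ j) \<beta>)" if "i < j" for i j \<beta>
  proof -
    let ?\<gamma> = "(osuc ^^ i) \<beta>"
    have \<gamma>': "(osuc ^^ j) \<beta> = (osuc ^^ (j - i)) ?\<gamma>"
      using that fun_cong[OF funpow_add[of "j - i" i osuc], of \<beta>] by simp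
    \<comment> \<open>Below \<open>?\<gamma>\<close> the functions \<open>w\<close> of all its finite successors agree, so the nodes form a chain.\<close>
    have "node ?\<gamma> \<subseteq>\<^sub>m node ((osuc ^^ j) \<beta>)"
      unfolding \<gamma>' using w_fun_osuc_funpow[of _ ?\<gamma> z "j - i"]
      by (auto simp: map_le_def node_def restrict_map_def)
    moreover have "node ?\<gamma> \<noteq> node ((osuc ^^ j) \<beta>)"
      using osuc_mono[OF that, of \<beta>] by (auto simp: node_def restrict_map_def dest: fun_cong[of _ _ ?\<gamma>])
    ultimately have "\<not> (node ?\<gamma> \<in> A n \<and> node ((osuc ^^ j) \<beta>) \<in> A n)" for n
      using A_antichain by blast
    then show ?thesis using idx by metis
  qed
  have idx_large: "\<exists>j. n \<le> idx ((osuc ^^ j) \<beta>)" for n \<beta>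
  proof (rule ccontr)
    assume "\<not> ?thesis"
    then have "(\<lambda>j. idx ((osuc ^^ j) \<beta>)) ` {..n} \<subseteq> {..<n}" by (auto simp: not_le)
    moreover have "inj_on (\<lambda>j. idx ((osuc ^^ j) \<beta>)) {..n}"
      by (rule linorder_inj_onI) (use idx_neq in auto)
    ultimately have "card {..n} \<le> card {..<n}" by (intro card_inj_on_le) auto
    then show False by simp
  qed
  define D where "D n = ?w ` {\<gamma>. n \<le> idx \<gamma>}" for n
  have "D n \<subseteq> topspace (moore_space C z)" for n
    using circ by (auto simp: D_def moore_space_def)
  moreover have "decseq D" by (auto simp: decseq_def D_def)
  moreover have "(\<Inter>n. D n) = {}"
  proof (rule ccontr)
    assume "(\<Inter>n. D n) \<noteq> {}"
    then obtain x where x: "\<And>n. x \<in> D n" by blast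
    then obtain \<gamma> where \<gamma>: "x = ?w \<gamma>" by (auto simp: D_def)
    have "x \<in> D (Suc (idx \<gamma>))" by (rule x)
    then show False using \<gamma> injD[OF w_fun_inj[OF assms(3), of C]] by (fastforce simp: D_def)
  qed
  ultimately obtain U where U: "\<And>n. openin (moore_space C z) (U n)" "\<And>n. D n \<subseteq> U n" "(\<Inter>n. U n) = {}"
    using Delta unfolding Delta_space_def by metis
  let ?E = "\<lambda>n. {\<beta>. ?w \<beta> \<notin> U n}"
  have "UNIV \<subseteq> (\<Union>n\<in>UNIV. ?E n)" using U(3) by blast
  then obtain n where "unbounded (UNIV \<inter> ?E n)"
    by (rule unbounded_cover_countable[OF unbounded_UNIV]) simp
  then have E: "unbounded (?E n)" by simp
  have "\<exists>j B m. finite B \<and> (\<forall>\<beta>'. (\<forall>\<xi>\<in>B. dist (?w \<beta>' \<xi>) (?w ((osuc ^^ j) \<beta>) \<xi>) < 1 / real (Suc m)) \<longrightarrow> ?w \<beta>' \<in> U n)"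
    for \<beta>
  proof -
    obtain j where "n \<le> idx ((osuc ^^ j) \<beta>)" using idx_large by blast
    then have "?w ((osuc ^^ j) \<beta>) \<in> U n" using U(2) by (auto simp: D_def)
    then obtain B \<epsilon> where B: "finite B" "0 < \<epsilon>"
      "\<And>\<beta>'. (\<And>\<xi>. \<xi> \<in> B \<Longrightarrow> dist (?w \<beta>' \<xi>) (?w ((osuc ^^ j) \<beta>) \<xi>) < \<epsilon>) \<Longrightarrow> ?w \<beta>' \<in> U n"
      by (rule moore_space_basic_neighbourhood[OF U(1) _ assms(2)]) blast
    obtain m where "1 / real (Suc m) < \<epsilon>" using B(2) nat_approx_posE by blast
    then have "\<forall>\<beta>'. (\<forall>\<xi>\<in>B. dist (?w \<beta>' \<xi>) (?w ((osuc ^^ j) \<beta>) \<xi>) < 1 / real (Suc m)) \<longrightarrow> ?w \<beta>' \<in> U n"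
      using B(3) less_trans by blast
    then show ?thesis using B(1) by blast
  qed
  then obtain j B m where B: "\<And>\<beta>. finite (B \<beta>)"
    "\<And>\<beta> \<beta>'. (\<And>\<xi>. \<xi> \<in> B \<beta> \<Longrightarrow> dist (?w \<beta>' \<xi>) (?w ((osuc ^^ j \<beta>) \<beta>) \<xi>) < 1 / real (Suc (m \<beta>))) \<Longrightarrow> ?w \<beta>' \<in> U n"
    by metis
  obtain c where c: "unbounded {\<beta> \<in> ?E n. m \<beta> = c}" by (rule unbounded_pigeonhole[OF E])
  let ?h = "\<lambda>\<beta>. ?w ((osuc ^^ j \<beta>) \<beta>)"
  show False
  proof (rule w_fun_approximates[where h = ?h and A = B, OF assms(2,3) c B(1)])
    show "0 < 1 / real (Suc c)" by simp
    show "?h \<beta> \<xi> = ?w \<beta> \<xi>" if "\<xi> < \<beta>" for \<beta> \<xi> using w_fun_osuc_funpow[OF that] by blast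
    show "?h \<beta> \<xi> \<in> circle" for \<beta> \<xi> by (rule circ)
    fix \<beta> \<beta>'
    assume "\<beta> \<in> {\<beta> \<in> ?E n. m \<beta> = c}" "\<beta>' \<in> {\<beta> \<in> ?E n. m \<beta> = c}"
      "\<And>\<xi>. \<xi> \<in> B \<beta> \<Longrightarrow> dist (?w \<beta>' \<xi>) (?h \<beta> \<xi>) < 1 / real (Suc c)"
    then show False using B(2)[of \<beta> \<beta>'] by simp
  qed
qed

end
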